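(* Let $l\ge2$ and let $L_{rel}$, $L$, $\mathbf{K}_n$, $\mathbf{SK}_n$, $\mathbf{C}_n$, $\mathbf{S}_n$ and the related notions be as in the context, $\mathbf{K}=\bigcup_n\mathbf{K}_n$, $\mathbf{C}=\bigcup_n\mathbf{C}_n$, $\mathbf{SK}=\bigcup_n\mathbf{SK}_n$, $\mathbf{S}=\bigcup_n\mathbf{S}_n$. Let $f:\mathbb{N}\to\mathbb{R}$ be such that $f(n)/\ln n\to\infty$ as $n\to\infty$. (i) Suppose that the proportion of $\mathcal{M}\in\mathbf{K}_n$ which are $f(n)$-richly $l$-coloured approaches $1$ as $n\to\infty$. Then, for every extension axiom $\varphi$ of $\mathbf{K}$, the proportion of $\mathcal{M}\in\mathbf{K}_n$ which satisfy $\varphi$ approaches $1$ as $n\to\infty$. Consequently, $\mathbf{K}$ has a zero-one law for the uniform probability measure. (ii) Suppose that the proportion of $\mathcal{M}\in\mathbf{C}_n$ which have an $f(n)$-rich $l$-colouring approaches $1$ as $n\to\infty$. Then, for every $l$-colour compatible extension axiom $\varphi$ of $\mathbf{C}$, the proportion of $\mathcal{M}\in\mathbf{C}_n$ which satisfy $\varphi$ approaches $1$ as $n\to\infty$. Moreover, $\mathbf{C}$ has a zero-one law for the uniform probability measure. (iii) If every relation symbol of $L_{rel}$ has arity at most $l$, then (i) and (ii) also hold with $\mathbf{K}_n,\mathbf{K},\mathbf{C}_n,\mathbf{C}$ replaced by $\mathbf{SK}_n,\mathbf{SK},\mathbf{S}_n,\mathbf{S}$ respectively, and "$l$-colouring"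 replaced by "strong $l$-colouring".
   Context: $l\ge2$ is a fixed integer. $L_{rel}$ is a first-order language with finite nonempty relational vocabulary, all symbols of arity at least $2$. $L$ has in addition new unary relation symbols $P_1,\ldots,P_l$; an element has colour $i$ if it satisfies $P_i$. $\mathbf{K}_n$ is the set of all $L$-structures $\mathcal{M}$ with universe $\{1,\ldots,n\}$ such that every element has exactly one colour and whenever $R$ is a relation symbol of $L_{rel}$ and $\mathcal{M}\models R(a_1,\ldots,a_m)$, at least two of the $a_i$ have different colours. $\mathbf{SK}_n$ is defined in the same way except that $\mathcal{M}\models R(a_1,\ldots,a_m)$ is required to imply that $a_i,a_j$ have different colours for all $i\neq j$. $\mathbf{C}_n=\{\mathcal{M}\upharpoonright L_{rel}:\mathcal{M}\in\mathbf{K}_n\}$, $\mathbf{S}_n=\{\mathcal{M}\upharpoonright L_{rel}:\mathcal{M}\in\mathbf{SK}_n\}$. A (strong) $l$-colouring of an $L_{rel}$-structure $\mathcal{M}$ is a function $\gamma:M\to\{1,\ldots,l\}$ such that giving each $a$ the colour $\gamma(a)$ satisfies the condition in the definition of $\mathbf{K}_n$ (respectively $\mathbf{SK}_n$); $\mathcal{M}$ is (strongly) $l$-colourable if it has one (similarly with $l-1$ colours). $\gamma$ is $m$-rich ($m\in\mathbb{R}$) if $|\gamma^{-1}(i)|\ge m$ for all $i\in\{1,\ldots,l\}$. $\mathcal{M}\in\mathbf{K}_n$ (or $\mathbf{SK}_n$) is $m$-richly $l$-coloured if for each $i$ at least $m$ elements have colour $i$. Proportions refer to the uniform probability measure. A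 zero-one law for the uniform probability measure means that for every sentence $\varphi$ of the language of the structures, the proportion of structures in the $n$-th set satisfying $\varphi$ converges to $0$ or to $1$. Extension axioms of $\mathbf{K}$ (similarly $\mathbf{SK}$): for finite $L$-structures $\mathcal{A}\subset\mathcal{B}$ ($\mathcal{A}$ proper, possibly empty), with $\mathcal{B}$ embeddable in a member of $\mathbf{K}$, the $\mathcal{B}/\mathcal{A}$-extension axiom says that every embedding of $\mathcal{A}$ into the structure extends to an embedding of $\mathcal{B}$. $l$-colour compatible extension axioms (read "strongly $l$-colourable", "strong $l$-colouring" throughout in the case of $\mathbf{S}$): Fix an $l$-colourable $L_{rel}$-structure $\mathcal{S}$ with universe $\{1,\ldots,s\}$, $s\ge3$, such that every $l$-colouring of $\mathcal{S}$ gives $s-1$ and $s$ the same colour, and for every colour $i$ there is an $l$-colouring of $\mathcal{S}$ giving both $s-1$ and $s$ the colour $i$ (such $\mathcal{S}$ exists). For a finite structure $\mathcal{D}$ with universe $\{1,\ldots,d\}$, $\chi_{\mathcal{D}}(x_1,\ldots,x_d)$ is a quantifier-free $L_{rel}$-formula such that $\mathcal{M}\models\chi_{\mathcal{D}}(a_1,\ldots,a_d)$ iff $a_i\mapsto i$ is an isomorphism from $\mathcal{M}\upharpoonright\{a_1,\ldots,a_d\}$ to $\mathcal{D}$. Let $\xi(y,z)$ be $y=z\vee\exists u_1,\ldots,u_{s-2}\,\chi_{\mathcal{S}}(u_1,\ldots,u_{s-2},y,z)$. Fix an $l$-colourable but not $(l-1)$-colourable $L_{rel}$-structure $\mathcal{U}$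 with universe $\{1,\ldots,u\}$ such that $l$ divides $u$ and every partition of the universe into $l$ parts of equal size gives an $l$-colouring of $\mathcal{U}$ (such $\mathcal{U}$ exists), and fix an $l$-colouring of $\mathcal{U}$ in which $1,\ldots,l$ have different colours. Let $I$ be the set of unordered pairs $\{i,j\}\subseteq\{1,\ldots,u\}$ with $i,j$ of the same colour in it, and let $\zeta(x_1,\ldots,x_u)$ be $\chi_{\mathcal{U}}(x_1,\ldots,x_u)\wedge\bigwedge_{\{i,j\}\in I}\xi(x_i,x_j)\wedge\bigwedge_{\{i,j\}\notin I}\neg\xi(x_i,x_j)$. Let $\mathcal{B}$ be a finite $l$-colourable $L_{rel}$-structure and $\mathcal{A}$ a proper substructure, with $A=\{1,\ldots,\alpha\}$, $B=\{1,\ldots,\beta\}$. For an $l$-colouring $\gamma'$ of $\mathcal{B}$ with restriction $\gamma=\gamma'\upharpoonright A$, and a permutation $\tau$ of $\{1,\ldots,l\}$, let $\theta_{\gamma,\tau}(x_1,\ldots,x_l,y_1,\ldots,y_\alpha)=\bigwedge_{j=1}^{\alpha}\xi(x_{\tau(\gamma(j))},y_j)$ and $\theta_{\gamma',\tau}(x_1,\ldots,x_l,y_1,\ldots,y_\beta)=\bigwedge_{j=1}^{\beta}\xi(x_{\tau(\gamma'(j))},y_j)$. The corresponding instance is the sentence $$\forall x_1,\ldots,x_u,y_1,\ldots,y_\alpha\,\exists y_{\alpha+1},\ldots,y_\beta\big([\zeta(\bar x)\wedge\chi_{\mathcal{A}}(y_1,\ldots,y_\alpha)\wedge\theta_{\gamma,\tau}]\to[\chi_{\mathcal{B}}(y_1,\ldots,y_\beta)\wedge\theta_{\gamma',\tau}]\big)$$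 (if $A=\emptyset$, the conjuncts $\chi_{\mathcal{A}},\theta_{\gamma,\tau}$ are omitted). The $l$-colour compatible $\mathcal{B}/\mathcal{A}$-extension axiom is the conjunction of all its (finitely many) instances over all $\gamma',\tau$. *)

theory Defs
  imports Complex_Main "HOL-Library.FuncSet" "HOL-Combinatorics.Permutations"
begin

text \<open>Relational vocabularies and structures. The interpretation of a symbol outside the
  vocabulary is required to be empty, so that a structure with a given universe is determined by
  the interpretation of the symbols of the vocabulary and counting structures is meaningful.\<close>

record 's vocab =
  syms :: "'s set"
  arity :: "'s \<Rightarrow> nat"

record ('s, 'a) struct =
  universe :: "'a set"
  interp :: "'s \<Rightarrow> 'a list set"

definition tuples :: "'a set \<Rightarrow> nat \<Rightarrow> 'a list set" where
  "tuples A m = {ts. set ts \<subseteq> A \<and> length ts = m}"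

definition is_struct :: "'s vocab \<Rightarrow> ('s, 'a) struct \<Rightarrow> bool" where
  "is_struct V M \<longleftrightarrow>
    (\<forall>R\<in>syms V. interp M R \<subseteq> tuples (universe M) (arity V R)) \<and>
    (\<forall>R. R \<notin> syms V \<longrightarrow> interp M R = {})"

definition substructure :: "('s, 'a) struct \<Rightarrow> ('s, 'a) struct \<Rightarrow> bool" where
  "substructure A B \<longleftrightarrow>
    universe A \<subseteq> universe B \<and>
    (\<forall>R. interp A R = {ts \<in> interp B R. set ts \<subseteq> universe A})"

definition embedding ::
  "'s vocab \<Rightarrow> ('a \<Rightarrow> 'b) \<Rightarrow> ('s, 'a) struct \<Rightarrow> ('s, 'b) struct \<Rightarrow> bool" where
  "embedding V g A M \<longleftrightarrow>
    inj_on g (universe A) \<and> g ` universe A \<subseteq> universe M \<and>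
    (\<forall>R\<in>syms V. \<forall>ts\<in>tuples (universe A) (arity V R).
       ts \<in> interp A R \<longleftrightarrow> map g ts \<in> interp M R)"


text \<open>First-order formulas with equality. The variables come in three disjoint countable
  families, written \<open>x\<^sub>i\<close>, \<open>y\<^sub>i\<close>, \<open>u\<^sub>i\<close> in the formulas below.\<close>

datatype var = VX nat | VY nat | VU nat

datatype 's form =
    Bot
  | Eq var var
  | Atom 's "var list"
  | Imp "'s form" "'s form"
  | All var "'s form"

abbreviation Neg :: "'s form \<Rightarrow> 's form" where "Neg p \<equiv> Imp p Bot"
abbreviation Top :: "'s form" where "Top \<equiv> Neg Bot"
abbreviation Or :: "'s form \<Rightarrow> 's form \<Rightarrow> 's form" where "Or p q \<equiv> Imp (Neg p) q"
abbreviation And :: "'s form \<Rightarrow> 's form \<Rightarrow> 's form" where "And p q \<equiv> Neg (Imp p (Neg q))"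
abbreviation Ex :: "var \<Rightarrow> 's form \<Rightarrow> 's form" where "Ex v p \<equiv> Neg (All v (Neg p))"

definition Alls :: "var list \<Rightarrow> 's form \<Rightarrow> 's form" where
  "Alls vs p = foldr All vs p"

definition Exs :: "var list \<Rightarrow> 's form \<Rightarrow> 's form" where
  "Exs vs p = foldr (\<lambda>v q. Ex v q) vs p"

text \<open>Conjunction of a finite set of formulas, in some unspecified order; the empty conjunction
  is \<open>Top\<close>.\<close>

definition BigAnd :: "'s form set \<Rightarrow> 's form" where
  "BigAnd F = foldr (\<lambda>p q. And p q) (SOME ps. distinct ps \<and> set ps = F) Top"

primrec fv :: "'s form \<Rightarrow> var set" where
  "fv Bot = {}"
| "fv (Eq v w) = {v, w}"
| "fv (Atom R vs) = set vs"
| "fv (Imp p q) = fv p \<union> fv q"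
| "fv (All v p) = fv p - {v}"

primrec form_of :: "'s vocab \<Rightarrow> 's form \<Rightarrow> bool" where
  "form_of V Bot \<longleftrightarrow> True"
| "form_of V (Eq v w) \<longleftrightarrow> True"
| "form_of V (Atom R vs) \<longleftrightarrow> R \<in> syms V \<and> length vs = arity V R"
| "form_of V (Imp p q) \<longleftrightarrow> form_of V p \<and> form_of V q"
| "form_of V (All v p) \<longleftrightarrow> form_of V p"

definition sentence :: "'s vocab \<Rightarrow> 's form \<Rightarrow> bool" where
  "sentence V p \<longleftrightarrow> form_of V p \<and> fv p = {}"

primrec sat :: "('s, 'a) struct \<Rightarrow> (var \<Rightarrow> 'a) \<Rightarrow> 's form \<Rightarrow> bool" where
  "sat M e Bot \<longleftrightarrow> False"
| "sat M e (Eq v w) \<longleftrightarrow> e v = e w"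
| "sat M e (Atom R vs) \<longleftrightarrow> map e vs \<in> interp M R"
| "sat M e (Imp p q) \<longleftrightarrow> (sat M e p \<longrightarrow> sat M e q)"
| "sat M e (All v p) \<longleftrightarrow> (\<forall>a\<in>universe M. sat M (e(v := a)) p)"

text \<open>Only used for sentences, whose truth value does not depend on the assignment.\<close>

definition models :: "('s, 'a) struct \<Rightarrow> 's form \<Rightarrow> bool" where
  "models M p \<longleftrightarrow> (\<forall>e. sat M e p)"

lemma sat_BigAnd:
  assumes "finite F"
  shows "sat M e (BigAnd F) \<longleftrightarrow> (\<forall>p\<in>F. sat M e p)"
proof -
  have "\<exists>ps. distinct ps \<and> set ps = F"
    using finite_distinct_list[OF assms] by blast
  then have "set (SOME ps. distinct ps \<and> set ps = F) = F"
    by (metis (mono_tags, lifting) someI_ex)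
  moreover have "sat M e (foldr (\<lambda>p q. And p q) ps Top) \<longleftrightarrow> (\<forall>p\<in>set ps. sat M e p)" for ps
    by (induction ps) auto
  ultimately show ?thesis
    unfolding BigAnd_def by simp
qed


definition proportion :: "'m set \<Rightarrow> ('m \<Rightarrow> bool) \<Rightarrow> real" where
  "proportion X P = real (card {M \<in> X. P M}) / real (card X)"

definition zero_one_law :: "'s vocab \<Rightarrow> (nat \<Rightarrow> ('s, 'a) struct set) \<Rightarrow> bool" where
  "zero_one_law V X \<longleftrightarrow>
    (\<forall>p. sentence V p \<longrightarrow>
      (\<lambda>n. proportion (X n) (\<lambda>M. models M p)) \<longlonglongrightarrow> 0 \<or>
      (\<lambda>n. proportion (X n) (\<lambda>M. models M p)) \<longlonglongrightarrow> 1)"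


text \<open>Colourings. \<open>Plain\<close> selects the notions for \<open>\<^bold>K\<close>, \<open>\<^bold>C\<close> and \<open>l\<close>-colourings, \<open>Strong\<close> those for
  \<open>\<^bold>S\<^bold>K\<close>, \<open>\<^bold>S\<close> and strong \<open>l\<close>-colourings; \<open>admissible\<close> is the condition on the list of colours of a
  tuple belonging to a relation.\<close>

datatype kind = Plain | Strong

fun admissible :: "kind \<Rightarrow> 'c list \<Rightarrow> bool" where
  "admissible Plain cs \<longleftrightarrow> (\<exists>i<length cs. \<exists>j<length cs. cs ! i \<noteq> cs ! j)"
| "admissible Strong cs \<longleftrightarrow>
    (\<forall>i<length cs. \<forall>j<length cs. i \<noteq> j \<longrightarrow> cs ! i \<noteq> cs ! j)"

definition colouring ::
  "kind \<Rightarrow> 'r vocab \<Rightarrow> nat \<Rightarrow> ('a \<Rightarrow> nat) \<Rightarrow> ('r, 'a) struct \<Rightarrow> bool" where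
  "colouring k V l \<gamma> M \<longleftrightarrow>
    \<gamma> \<in> universe M \<rightarrow>\<^sub>E {1..l} \<and>
    (\<forall>R\<in>syms V. \<forall>ts\<in>interp M R. admissible k (map \<gamma> ts))"

definition colourable :: "kind \<Rightarrow> 'r vocab \<Rightarrow> nat \<Rightarrow> ('r, 'a) struct \<Rightarrow> bool" where
  "colourable k V l M \<longleftrightarrow> (\<exists>\<gamma>. colouring k V l \<gamma> M)"

definition rich :: "nat \<Rightarrow> real \<Rightarrow> ('a \<Rightarrow> nat) \<Rightarrow> ('r, 'a) struct \<Rightarrow> bool" where
  "rich l m \<gamma> M \<longleftrightarrow> (\<forall>i\<in>{1..l}. m \<le> real (card {a \<in> universe M. \<gamma> a = i}))"

definition has_rich_colouring ::
  "kind \<Rightarrow> 'r vocab \<Rightarrow> nat \<Rightarrow> real \<Rightarrow> ('r, 'a) struct \<Rightarrow> bool" where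
  "has_rich_colouring k V l m M \<longleftrightarrow> (\<exists>\<gamma>. colouring k V l \<gamma> M \<and> rich l m \<gamma> M)"


text \<open>The language \<open>L\<close>: \<open>Inl R\<close> is the symbol \<open>R\<close> of \<open>L\<^sub>r\<^sub>e\<^sub>l\<close>, and \<open>Inr i\<close> is the colour predicate \<open>P\<^sub>i\<close>.\<close>

definition colour_vocab :: "'r vocab \<Rightarrow> nat \<Rightarrow> ('r + nat) vocab" where
  "colour_vocab V l =
    \<lparr>syms = Inl ` syms V \<union> Inr ` {1..l}, arity = case_sum (arity V) (\<lambda>_. 1)\<rparr>"

definition has_colour :: "('r + nat, 'a) struct \<Rightarrow> 'a \<Rightarrow> nat \<Rightarrow> bool" where
  "has_colour M a i \<longleftrightarrow> [a] \<in> interp M (Inr i)"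

definition colour_of :: "('r + nat, 'a) struct \<Rightarrow> 'a \<Rightarrow> nat" where
  "colour_of M a = (THE i. has_colour M a i)"

definition reduct :: "('r + nat, 'a) struct \<Rightarrow> ('r, 'a) struct" where
  "reduct M = \<lparr>universe = universe M, interp = (\<lambda>R. interp M (Inl R))\<rparr>"

text \<open>\<open>KK Plain V l n\<close> is \<open>\<^bold>K\<^sub>n\<close> and \<open>KK Strong V l n\<close> is \<open>\<^bold>S\<^bold>K\<^sub>n\<close>; likewise \<open>CC\<close> gives \<open>\<^bold>C\<^sub>n\<close> and \<open>\<^bold>S\<^sub>n\<close>.\<close>

definition KK :: "kind \<Rightarrow> 'r vocab \<Rightarrow> nat \<Rightarrow> nat \<Rightarrow> ('r + nat, nat) struct set" where
  "KK k V l n = {M. is_struct (colour_vocab V l) M \<and> universe M = {1..n} \<and>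
     (\<forall>a\<in>universe M. \<exists>!i. i \<in> {1..l} \<and> has_colour M a i) \<and>
     (\<forall>R\<in>syms V. \<forall>ts\<in>interp M (Inl R). admissible k (map (colour_of M) ts))}"

definition CC :: "kind \<Rightarrow> 'r vocab \<Rightarrow> nat \<Rightarrow> nat \<Rightarrow> ('r, nat) struct set" where
  "CC k V l n = reduct ` KK k V l n"

definition richly_coloured :: "nat \<Rightarrow> real \<Rightarrow> ('r + nat, 'a) struct \<Rightarrow> bool" where
  "richly_coloured l m M \<longleftrightarrow>
    (\<forall>i\<in>{1..l}. m \<le> real (card {a \<in> universe M. has_colour M a i}))"


text \<open>\<open>extension_pair k V l A B\<close> says that the \<open>B/A\<close>-extension axiom is one of the extension axioms
  of \<open>\<^bold>K\<close> (or \<open>\<^bold>S\<^bold>K\<close>). Taking structures on sets of natural numbers loses no finite structure up to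
  isomorphism.\<close>

definition extension_pair ::
  "kind \<Rightarrow> 'r vocab \<Rightarrow> nat \<Rightarrow> ('r + nat, nat) struct \<Rightarrow> ('r + nat, nat) struct \<Rightarrow> bool" where
  "extension_pair k V l A B \<longleftrightarrow>
    is_struct (colour_vocab V l) A \<and> is_struct (colour_vocab V l) B \<and>
    finite (universe B) \<and> substructure A B \<and> universe A \<noteq> universe B \<and>
    (\<exists>n. \<exists>M\<in>KK k V l n. \<exists>g. embedding (colour_vocab V l) g B M)"

definition satisfies_extension_axiom ::
  "'s vocab \<Rightarrow> ('s, 'a) struct \<Rightarrow> ('s, 'a) struct \<Rightarrow> ('s, 'b) struct \<Rightarrow> bool" where
  "satisfies_extension_axiom V A B M \<longleftrightarrow>
    (\<forall>g. embedding V g A M \<longrightarrow>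
      (\<exists>h. embedding V h B M \<and> (\<forall>a\<in>universe A. h a = g a)))"


text \<open>The formula \<open>\<chi>\<^sub>D\<close>, with the variable \<open>v i\<close> in place of \<open>x\<^sub>i\<close>: the conjunction of the atomic diagram
  of \<open>D\<close>.\<close>

definition chi :: "'r vocab \<Rightarrow> ('r, nat) struct \<Rightarrow> (nat \<Rightarrow> var) \<Rightarrow> 'r form" where
  "chi V D v = BigAnd (
     {Neg (Eq (v i) (v j)) | i j. i \<in> universe D \<and> j \<in> universe D \<and> i \<noteq> j} \<union>
     {Atom R (map v ts) | R ts. R \<in> syms V \<and> ts \<in> interp D R} \<union>
     {Neg (Atom R (map v ts)) | R ts.
        R \<in> syms V \<and> ts \<in> tuples (universe D) (arity V R) \<and> ts \<notin> interp D R})"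

lemma sat_chi:
  assumes "finite (syms V)" and "is_struct V D" and "finite (universe D)"
    and "\<And>i. i \<in> universe D \<Longrightarrow> e (v i) \<in> universe M"
  shows "sat M e (chi V D v) \<longleftrightarrow> embedding V (\<lambda>i. e (v i)) D M"
proof -
  let ?E = "{Neg (Eq (v i) (v j)) | i j. i \<in> universe D \<and> j \<in> universe D \<and> i \<noteq> j}"
  let ?P = "{Atom R (map v ts) | R ts. R \<in> syms V \<and> ts \<in> interp D R}"
  let ?N = "{Neg (Atom R (map v ts)) | R ts.
        R \<in> syms V \<and> ts \<in> tuples (universe D) (arity V R) \<and> ts \<notin> interp D R}"
  let ?T = "SIGMA R:syms V. tuples (universe D) (arity V R)"
  have sub: "\<And>R ts. R \<in> syms V \<Longrightarrow> ts \<in> interp D R \<Longrightarrow> ts \<in> tuples (universe D) (arity V R)"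
    using assms(2) by (auto simp: is_struct_def)
  have "finite (tuples (universe D) m)" for m
    using finite_lists_length_eq[OF assms(3), of m] by (simp add: tuples_def)
  then have fT: "finite ?T"
    using assms(1) by (intro finite_SigmaI)
  have "?P \<subseteq> (\<lambda>(R, ts). Atom R (map v ts)) ` ?T"
    using sub by (clarify, rule_tac x = "(R, ts)" in image_eqI) simp_all
  then have fP: "finite ?P" using finite_imageI[OF fT] by (rule finite_subset)
  have "?N \<subseteq> (\<lambda>(R, ts). Neg (Atom R (map v ts))) ` ?T"
    by (clarify, rule_tac x = "(R, ts)" in image_eqI) simp_all
  then have fN: "finite ?N" using finite_imageI[OF fT] by (rule finite_subset)
  have "?E \<subseteq> (\<lambda>(i, j). Neg (Eq (v i) (v j))) ` (universe D \<times> universe D)"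
    by (clarify, rule_tac x = "(i, j)" in image_eqI) simp_all
  then have fE: "finite ?E"
    by (rule finite_subset) (intro finite_imageI finite_cartesian_product assms(3))
  have "sat M e (chi V D v) \<longleftrightarrow> (\<forall>p \<in> ?E \<union> ?P \<union> ?N. sat M e p)"
    unfolding chi_def using fE fP fN by (intro sat_BigAnd finite_UnI)
  also have "\<dots> \<longleftrightarrow> (\<forall>p\<in>?E. sat M e p) \<and> (\<forall>p\<in>?P. sat M e p) \<and> (\<forall>p\<in>?N. sat M e p)"
    by (simp only: ball_Un conj_assoc)
  also have "(\<forall>p\<in>?E. sat M e p) \<longleftrightarrow> (\<forall>i\<in>universe D. \<forall>j\<in>universe D. i \<noteq> j \<longrightarrow>
      sat M e (Neg (Eq (v i) (v j))))"
    by blast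
  also have "\<dots> \<longleftrightarrow> inj_on (\<lambda>i. e (v i)) (universe D)"
    by (auto simp: inj_on_def)
  also have "(\<forall>p\<in>?P. sat M e p) \<longleftrightarrow>
      (\<forall>R\<in>syms V. \<forall>ts\<in>interp D R. sat M e (Atom R (map v ts)))"
    by blast
  also have "(\<forall>p\<in>?N. sat M e p) \<longleftrightarrow> (\<forall>R\<in>syms V. \<forall>ts\<in>tuples (universe D) (arity V R).
      ts \<notin> interp D R \<longrightarrow> sat M e (Neg (Atom R (map v ts))))"
    by blast
  finally show ?thesis
    using assms(4) sub by (simp add: embedding_def comp_def image_subset_iff) blast
qed


text \<open>The structures \<open>\<S>\<close> and \<open>\<U>\<close> (the latter with its chosen colouring \<open>\<delta>\<close>) that enter the formulas
  \<open>\<xi>\<close> and \<open>\<zeta>\<close>.\<close>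

definition xi_structure :: "kind \<Rightarrow> 'r vocab \<Rightarrow> nat \<Rightarrow> ('r, nat) struct \<Rightarrow> bool" where
  "xi_structure k V l S \<longleftrightarrow>
    is_struct V S \<and> colourable k V l S \<and>
    (\<exists>s\<ge>3. universe S = {1..s} \<and>
       (\<forall>\<gamma>. colouring k V l \<gamma> S \<longrightarrow> \<gamma> (s - 1) = \<gamma> s) \<and>
       (\<forall>i\<in>{1..l}. \<exists>\<gamma>. colouring k V l \<gamma> S \<and> \<gamma> (s - 1) = i \<and> \<gamma> s = i))"

definition zeta_structure ::
  "kind \<Rightarrow> 'r vocab \<Rightarrow> nat \<Rightarrow> ('r, nat) struct \<Rightarrow> (nat \<Rightarrow> nat) \<Rightarrow> bool" where
  "zeta_structure k V l U \<delta> \<longleftrightarrow>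
    is_struct V U \<and> colourable k V l U \<and> \<not> colourable k V (l - 1) U \<and>
    (\<exists>u. universe U = {1..u} \<and> l dvd u \<and>
       (\<forall>\<gamma> \<in> {1..u} \<rightarrow>\<^sub>E {1..l}.
          (\<forall>i\<in>{1..l}. card {a \<in> {1..u}. \<gamma> a = i} = u div l) \<longrightarrow> colouring k V l \<gamma> U)) \<and>
    colouring k V l \<delta> U \<and> {1..l} \<subseteq> universe U \<and> inj_on \<delta> {1..l}"

text \<open>\<open>xi V S y z\<close> is only used for variables \<open>y\<close>, \<open>z\<close> that are not of the form \<open>VU i\<close>.\<close>

definition xi :: "'r vocab \<Rightarrow> ('r, nat) struct \<Rightarrow> var \<Rightarrow> var \<Rightarrow> 'r form" where
  "xi V S y z =
    (let s = card (universe S) in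
      Or (Eq y z)
         (Exs (map VU [1..<s - 1])
            (chi V S (\<lambda>i. if i = s - 1 then y else if i = s then z else VU i))))"

text \<open>One conjunct for each unordered pair: the pairs are listed with the smaller index first.\<close>

definition zeta ::
  "'r vocab \<Rightarrow> ('r, nat) struct \<Rightarrow> ('r, nat) struct \<Rightarrow> (nat \<Rightarrow> nat) \<Rightarrow> 'r form" where
  "zeta V S U \<delta> =
    And (chi V U VX)
     (And (BigAnd {xi V S (VX i) (VX j) | i j.
             i \<in> universe U \<and> j \<in> universe U \<and> i < j \<and> \<delta> i = \<delta> j})
          (BigAnd {Neg (xi V S (VX i) (VX j)) | i j.
             i \<in> universe U \<and> j \<in> universe U \<and> i < j \<and> \<delta> i \<noteq> \<delta> j}))"

text \<open>The formula \<open>\<theta>\<^sub>\<gamma>\<^sub>,\<^sub>\<tau>\<close> for a colouring \<open>\<gamma>\<close> of a structure with universe \<open>D\<close>.\<close>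

definition theta ::
  "'r vocab \<Rightarrow> ('r, nat) struct \<Rightarrow> nat set \<Rightarrow> (nat \<Rightarrow> nat) \<Rightarrow> (nat \<Rightarrow> nat) \<Rightarrow> 'r form" where
  "theta V S D \<gamma> \<tau> = BigAnd {xi V S (VX (\<tau> (\<gamma> j))) (VY j) | j. j \<in> D}"

text \<open>If \<open>A\<close> is empty, then \<open>chi V A VY\<close> and the first occurrence of \<open>theta\<close> are empty conjunctions
  (all arities are positive), which amounts to omitting them.\<close>

definition compatible_instance ::
  "'r vocab \<Rightarrow> ('r, nat) struct \<Rightarrow> ('r, nat) struct \<Rightarrow> (nat \<Rightarrow> nat) \<Rightarrow>
   ('r, nat) struct \<Rightarrow> ('r, nat) struct \<Rightarrow> (nat \<Rightarrow> nat) \<Rightarrow> (nat \<Rightarrow> nat) \<Rightarrow> 'r form" where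
  "compatible_instance V S U \<delta> A B \<gamma>' \<tau> =
    (let u = card (universe U); \<alpha> = card (universe A); \<beta> = card (universe B);
         \<gamma> = restrict \<gamma>' (universe A) in
      Alls (map VX [1..<u + 1] @ map VY [1..<\<alpha> + 1])
        (Exs (map VY [\<alpha> + 1..<\<beta> + 1])
          (Imp (And (zeta V S U \<delta>) (And (chi V A VY) (theta V S (universe A) \<gamma> \<tau>)))
               (And (chi V B VY) (theta V S (universe B) \<gamma>' \<tau>)))))"

definition compatible_axiom ::
  "kind \<Rightarrow> 'r vocab \<Rightarrow> nat \<Rightarrow> ('r, nat) struct \<Rightarrow> ('r, nat) struct \<Rightarrow> (nat \<Rightarrow> nat) \<Rightarrow>
   ('r, nat) struct \<Rightarrow> ('r, nat) struct \<Rightarrow> 'r form" where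
  "compatible_axiom k V l S U \<delta> A B =
    BigAnd {compatible_instance V S U \<delta> A B \<gamma>' \<tau> | \<gamma>' \<tau>.
      colouring k V l \<gamma>' B \<and> \<tau> permutes {1..l}}"

definition compatible_pair ::
  "kind \<Rightarrow> 'r vocab \<Rightarrow> nat \<Rightarrow> ('r, nat) struct \<Rightarrow> ('r, nat) struct \<Rightarrow> bool" where
  "compatible_pair k V l A B \<longleftrightarrow>
    is_struct V A \<and> is_struct V B \<and> colourable k V l B \<and> substructure A B \<and>
    (\<exists>\<alpha> \<beta>. universe A = {1..\<alpha>} \<and> universe B = {1..\<beta>} \<and> \<alpha> < \<beta>)"

end

theory Submission
  imports Defs
begin

text \<open>Call a coloured structure \<open>m\<close>-generic if every one-point extension type over at most \<open>m\<close>
  points that is compatible with the colours is realised. Given the colouring, the structures are the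
  subsets of the set of admissible tuples, and distinct candidates for the new point involve
  disjoint blocks of tuples; so a fixed type over fixed points fails for at most a fraction
  \<open>(1 - 2\<^sup>-\<^sup>q)\<^bsup>f(n) - m\<^esup>\<close> of the structures with an \<open>f(n)\<close>-rich colouring. As \<open>f\<close> dominates \<open>ln\<close>,
  this beats the \<open>n\<^sup>m\<close> choices of the points, and almost all richly coloured structures are generic.
  A generic structure satisfies the extension axioms, and a back-and-forth argument shows that two
  structures that are generic enough agree on any given sentence.

  For uncoloured structures, a generic colouring is the only one up to renaming colours, because
  the relation \<open>\<xi>\<close>, which every colouring respects, holds of any two points of the same colour.
  Hence a structure with a generic colouring has boundedly many colourings, and the counting
  carries over from coloured structures to their reducts.\<close>

section \<open>Structures as colourings with reducts\<close>

text \<open>The uniform measure on reducts is awkward because the number of colourings varies from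
  structure to structure; the admissible tuples become independent coin flips only once a colouring
  is fixed. So all counting is done on pairs in \<open>coloured\<close>, and the return to reducts
  is asymmetric. A structure with a rich but not generic colouring contributes at least one bad
  pair, so bad structures need no bound on how many colourings they have. Good structures do need
  one, since the total number of rich pairs, against which the bad pairs are measured, must be
  compared with the number of structures. The zero-one laws are derived directly, sentence by
  sentence, from the agreement of generic structures of any two sizes; no limit theory enters. The
  compatible axioms come with a structure \<S>, but the zero-one law for reducts mentions none, so
  one has to be constructed. The bound l on the arities enters the strong case there: the
  construction uses a clique on l vertices, and such a clique must carry at least one edge.\<close>

lemma map_eq_on_iff_inj: "inj_on f A \<Longrightarrow> set xs \<subseteq> A \<Longrightarrow> set ys \<subseteq> A \<Longrightarrow> map f xs = map f ys \<longleftrightarrow> xs = ys"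
  by (meson inj_on_map_eq_map inj_on_subset le_sup_iff)

text \<open>\<open>colouring\<close> forces \<gamma> to be \<open>undefined\<close> off the
  universe. Hence the pairs correspond one to one to the members of \<open>KK\<close>, and the fibre
  over M is exactly its set of colourings.\<close>

definition coloured :: "kind \<Rightarrow> 'r vocab \<Rightarrow> nat \<Rightarrow> nat \<Rightarrow> ((nat \<Rightarrow> nat) \<times> ('r, nat) struct) set" where
  "coloured k V l n =
    {(\<gamma>, M). is_struct V M \<and> universe M = {1..n} \<and> colouring k V l \<gamma> M}"

definition expand :: "(nat \<Rightarrow> nat) \<Rightarrow> ('r, nat) struct \<Rightarrow> ('r + nat, nat) struct" where
  "expand \<gamma> M = \<lparr>universe = universe M,
     interp = case_sum (interp M) (\<lambda>i. {[a] | a. a \<in> universe M \<and> \<gamma> a = i})\<rparr>"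

lemma expand_simps [simp]:
  "universe (expand \<gamma> M) = universe M"
  "interp (expand \<gamma> M) (Inl R) = interp M R"
  "interp (expand \<gamma> M) (Inr i) = {[a] | a. a \<in> universe M \<and> \<gamma> a = i}"
  "has_colour (expand \<gamma> M) a i \<longleftrightarrow> a \<in> universe M \<and> \<gamma> a = i"
  "reduct (expand \<gamma> M) = M"
  by (auto simp: expand_def has_colour_def reduct_def)

lemma colour_of_expand [simp]: "a \<in> universe M \<Longrightarrow> colour_of (expand \<gamma> M) a = \<gamma> a"
  by (simp add: colour_of_def)

lemma colour_vocab_simps [simp]:
  "syms (colour_vocab V l) = Inl ` syms V \<union> Inr ` {1..l}"
  "arity (colour_vocab V l) (Inl R) = arity V R"
  "arity (colour_vocab V l) (Inr i) = 1"
  by (auto simp: colour_vocab_def)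

lemma is_struct_tuples: "is_struct V M \<Longrightarrow> ts \<in> interp M R \<Longrightarrow> ts \<in> tuples (universe M) (arity V R)"
  by (auto simp: is_struct_def)

lemma is_struct_set: "is_struct V M \<Longrightarrow> ts \<in> interp M R \<Longrightarrow> set ts \<subseteq> universe M"
  by (drule (1) is_struct_tuples) (auto simp: tuples_def)

lemma expand_in_KK:
  assumes "(\<gamma>, M) \<in> coloured k V l n"
  shows "expand \<gamma> M \<in> KK k V l n"
proof -
  have M: "is_struct V M" "universe M = {1..n}" "colouring k V l \<gamma> M"
    using assms by (auto simp: coloured_def)
  have im: "\<gamma> a \<in> {1..l}" if "a \<in> universe M" for a
    using M(3) that by (auto simp: colouring_def PiE_iff)
  have "is_struct (colour_vocab V l) (expand \<gamma> M)"
    unfolding is_struct_def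
  proof (intro conjI ballI allI impI)
    fix R assume "R \<in> syms (colour_vocab V l)"
    then show "interp (expand \<gamma> M) R \<subseteq> tuples (universe (expand \<gamma> M)) (arity (colour_vocab V l) R)"
      using is_struct_tuples[OF M(1)] by (auto simp: tuples_def subset_iff)
  next
    fix R assume "R \<notin> syms (colour_vocab V l)"
    then show "interp (expand \<gamma> M) R = {}"
      using M(1) im by (cases R) (auto simp: is_struct_def)
  qed
  moreover have "admissible k (map (colour_of (expand \<gamma> M)) ts)"
    if "R \<in> syms V" "ts \<in> interp M R" for R ts
  proof -
    have "map (colour_of (expand \<gamma> M)) ts = map \<gamma> ts"
      using is_struct_set[OF M(1) that(2)] by auto
    then show ?thesis using M(3) that unfolding colouring_def by metis
  qed
  ultimately show ?thesis
    using M(2) im by (auto simp: KK_def)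
qed

lemma KK_cases:
  assumes "N \<in> KK k V l n"
  obtains \<gamma> where "(\<gamma>, reduct N) \<in> coloured k V l n" "N = expand \<gamma> (reduct N)"
proof
  have N: "is_struct (colour_vocab V l) N" "universe N = {1..n}"
    and ex: "\<And>a. a \<in> universe N \<Longrightarrow> \<exists>!i. i \<in> {1..l} \<and> has_colour N a i"
    and adm: "\<And>R ts. R \<in> syms V \<Longrightarrow> ts \<in> interp N (Inl R) \<Longrightarrow> admissible k (map (colour_of N) ts)"
    using assms by (auto simp: KK_def)
  define \<gamma> where "\<gamma> = restrict (colour_of N) {1..n}"
  \<comment> \<open>\<open>colour_of\<close> looks for a colour among all natural numbers, while
    membership in \<open>KK\<close> gives uniqueness only within \<open>{1..l}\<close>. The gap is
    closed by \<open>is_struct\<close>, which empties the predicates outside the vocabulary.\<close>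
  have range: "i \<in> {1..l}" if "has_colour N a i" for a i
    using N(1) that by (auto simp: is_struct_def has_colour_def)
  have col: "has_colour N a i \<longleftrightarrow> i = \<gamma> a" if a: "a \<in> {1..n}" for a i
  proof -
    obtain j where j: "j \<in> {1..l}" "has_colour N a j"
      and uniq: "\<And>i. i \<in> {1..l} \<and> has_colour N a i \<Longrightarrow> i = j"
      using ex[of a] a N(2) by auto
    have "colour_of N a = j"
      unfolding colour_of_def using j uniq range by (intro the_equality) blast+
    then show ?thesis using a j uniq range by (auto simp: \<gamma>_def)
  qed
  have [simp]: "universe (reduct N) = {1..n}" "interp (reduct N) R = interp N (Inl R)" for R
    using N(2) by (auto simp: reduct_def)
  have str: "is_struct V (reduct N)"
    unfolding is_struct_def
  proof (intro conjI ballI allI impI subsetI)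
    fix R ts assume "R \<in> syms V" "ts \<in> interp (reduct N) R"
    then show "ts \<in> tuples (universe (reduct N)) (arity V R)"
      using is_struct_tuples[OF N(1), of ts "Inl R"] N(2) by simp
  next
    fix R assume "R \<notin> syms V"
    then have "Inl R \<notin> syms (colour_vocab V l)" by auto
    then show "interp (reduct N) R = {}"
      using N(1) by (simp add: is_struct_def)
  qed
  have "map \<gamma> ts = map (colour_of N) ts" if "ts \<in> interp N (Inl R)" for R ts
    using is_struct_set[OF N(1) that] N(2) by (auto simp: \<gamma>_def)
  then have "\<forall>R\<in>syms V. \<forall>ts\<in>interp N (Inl R). admissible k (map \<gamma> ts)"
    using adm by metis
  moreover have "\<gamma> a \<in> {1..l}" if "a \<in> {1..n}" for a
    using col[OF that, of "\<gamma> a"] range[of a "\<gamma> a"] by simp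
  then have "\<gamma> \<in> {1..n} \<rightarrow>\<^sub>E {1..l}"
    by (auto simp: \<gamma>_def)
  ultimately have "colouring k V l \<gamma> (reduct N)"
    by (simp add: colouring_def)
  with str show "(\<gamma>, reduct N) \<in> coloured k V l n"
    by (simp add: coloured_def)
  have "interp N (Inr i) = {[a] | a. a \<in> {1..n} \<and> \<gamma> a = i}" for i
  proof (cases "i \<in> {1..l}")
    case True
    have "ts \<in> interp N (Inr i) \<longleftrightarrow> (\<exists>a. ts = [a] \<and> a \<in> {1..n} \<and> \<gamma> a = i)" for ts
    proof
      assume ts: "ts \<in> interp N (Inr i)"
      with True have "ts \<in> tuples {1..n} 1"
        using is_struct_tuples[OF N(1) ts] N(2) by simp
      then obtain a where "ts = [a]" "a \<in> {1..n}"
        by (auto simp: tuples_def length_Suc_conv)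
      then show "\<exists>a. ts = [a] \<and> a \<in> {1..n} \<and> \<gamma> a = i"
        using ts col by (auto simp: has_colour_def)
    qed (use col in \<open>auto simp: has_colour_def\<close>)
    then show ?thesis by auto
  next
    case False
    then have "Inr i \<notin> syms (colour_vocab V l)" by auto
    then have "interp N (Inr i) = {}"
      using N(1) unfolding is_struct_def by metis
    moreover have "\<gamma> a \<noteq> i" if "a \<in> {1..n}" for a
      using col[OF that, of i] range[of a i] False by metis
    ultimately show ?thesis by auto
  qed
  then have "interp N R = interp (expand \<gamma> (reduct N)) R" for R
    by (cases R) auto
  then show "N = expand \<gamma> (reduct N)"
    using N(2) by (intro struct.equality) auto
qed

lemma KK_eq: "KK k V l n = (\<lambda>(\<gamma>, M). expand \<gamma> M) ` coloured k V l n"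
  by (auto intro: expand_in_KK elim!: KK_cases intro!: image_eqI[rotated])

lemma colouring_eqI:
  assumes "colouring k V l \<gamma> M" "colouring k V l \<gamma>' M" "\<And>a. a \<in> universe M \<Longrightarrow> \<gamma> a = \<gamma>' a"
  shows "\<gamma> = \<gamma>'"
  using assms by (auto simp: colouring_def intro: PiE_ext)

lemma inj_on_expand: "inj_on (\<lambda>(\<gamma>, M). expand \<gamma> M) (coloured k V l n)"
proof (intro inj_onI, clarify)
  fix \<gamma> \<gamma>' and M M' :: "('a, nat) struct"
  assume *: "(\<gamma>, M) \<in> coloured k V l n" "(\<gamma>', M') \<in> coloured k V l n"
    and eq: "expand \<gamma> M = expand \<gamma>' M'"
  have M: "M = M'"
    using arg_cong[OF eq, of reduct] by simp
  have "\<gamma> a = \<gamma>' a" if "a \<in> universe M" for a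
    using arg_cong[OF eq, of "\<lambda>N. has_colour N a (\<gamma> a)"] that by simp
  then have "\<gamma> = \<gamma>'"
    using * M by (intro colouring_eqI[of k V l \<gamma> M]) (auto simp: coloured_def)
  with M show "\<gamma> = \<gamma>' \<and> M = M'" by simp
qed

lemma CC_eq: "CC k V l n = snd ` coloured k V l n"
  by (auto simp: CC_def KK_eq image_image split_beta)

section \<open>Generic coloured structures\<close>

text \<open>The vertices of our structures are positive; in the pattern \<open>T\<close> the number \<open>0\<close> stands for the
  new point \<open>b\<close> of colour \<open>i\<close>.\<close>

definition generic :: "kind \<Rightarrow> 'r vocab \<Rightarrow> nat \<Rightarrow> nat \<Rightarrow> (nat \<Rightarrow> nat) \<Rightarrow> ('r, nat) struct \<Rightarrow> bool" where
  "generic k V l m \<gamma> M \<longleftrightarrow>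
    (\<forall>X i T. X \<subseteq> universe M \<and> card X \<le> m \<and> i \<in> {1..l} \<and>
       T \<subseteq> {(R, ts). R \<in> syms V \<and> ts \<in> tuples (insert 0 X) (arity V R) \<and> 0 \<in> set ts \<and>
                      admissible k (map (\<gamma>(0 := i)) ts)} \<longrightarrow>
       (\<exists>b\<in>universe M - X. \<gamma> b = i \<and>
         (\<forall>R\<in>syms V. \<forall>ts\<in>tuples (insert 0 X) (arity V R). 0 \<in> set ts \<longrightarrow>
            (map (id(0 := b)) ts \<in> interp M R \<longleftrightarrow> (R, ts) \<in> T))))"

lemma genericE:
  assumes "generic k V l m \<gamma> M" "X \<subseteq> universe M" "card X \<le> m" "i \<in> {1..l}"
    and "T \<subseteq> {(R, ts). R \<in> syms V \<and> ts \<in> tuples (insert 0 X) (arity V R) \<and> 0 \<in> set ts \<and>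
           admissible k (map (\<gamma>(0 := i)) ts)}"
  obtains b where "b \<in> universe M" "b \<notin> X" "\<gamma> b = i"
    and "\<And>R ts. R \<in> syms V \<Longrightarrow> ts \<in> tuples (insert 0 X) (arity V R) \<Longrightarrow> 0 \<in> set ts \<Longrightarrow>
      map (id(0 := b)) ts \<in> interp M R \<longleftrightarrow> (R, ts) \<in> T"
proof -
  have "\<exists>b\<in>universe M - X. \<gamma> b = i \<and>
      (\<forall>R\<in>syms V. \<forall>ts\<in>tuples (insert 0 X) (arity V R). 0 \<in> set ts \<longrightarrow>
         (map (id(0 := b)) ts \<in> interp M R \<longleftrightarrow> (R, ts) \<in> T))"
    by (rule assms(1)[unfolded generic_def, rule_format,
        OF conjI[OF assms(2) conjI[OF assms(3) conjI[OF assms(4,5)]]]])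
  then show ?thesis using that by blast
qed

section \<open>Partial colour-preserving isomorphisms and their extension\<close>

text \<open>The domain X is separate from \<open>universe D\<close>, so that one notion covers the
  positions of a back-and-forth game and, for X the whole universe, embeddings that respect
  colours.\<close>

definition colour_embedding ::
  "'r vocab \<Rightarrow> ('a \<Rightarrow> nat) \<Rightarrow> ('r, 'a) struct \<Rightarrow> ('b \<Rightarrow> nat) \<Rightarrow> ('r, 'b) struct \<Rightarrow> 'a set \<Rightarrow>
   ('a \<Rightarrow> 'b) \<Rightarrow> bool" where
  "colour_embedding V c D \<gamma> M X g \<longleftrightarrow>
    inj_on g X \<and> g ` X \<subseteq> universe M \<and> (\<forall>x\<in>X. \<gamma> (g x) = c x) \<and>
    (\<forall>R\<in>syms V. \<forall>ts\<in>tuples X (arity V R). ts \<in> interp D R \<longleftrightarrow> map g ts \<in> interp M R)"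

text \<open>Lets the "back" half of the back-and-forth argument be an instance of the "forth"
  half.\<close>

lemma colour_embedding_inv:
  assumes "colour_embedding V c D \<gamma> M X g" "X \<subseteq> universe D"
  shows "colour_embedding V \<gamma> M c D (g ` X) (inv_into X g)"
proof -
  have inj: "inj_on g X" using assms(1) by (simp add: colour_embedding_def)
  have "map g (map (inv_into X g) us) = us" "map (inv_into X g) us \<in> tuples X j"
    if "us \<in> tuples (g ` X) j" for us j
    using that by (auto simp: tuples_def f_inv_into_f inv_into_into subset_iff intro!: map_idI)
  then show ?thesis
    using assms inj unfolding colour_embedding_def
    by (auto simp: inj_on_inv_into inv_into_into f_inv_into_f)
qed

lemma colour_embedding_mono:
  "colour_embedding V c D \<gamma> M X g \<Longrightarrow> Y \<subseteq> X \<Longrightarrow> colour_embedding V c D \<gamma> M Y g"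
  unfolding colour_embedding_def tuples_def by (blast intro: inj_on_subset)

lemma extend_by_point:
  assumes gen: "generic k V l m \<gamma> M" and zero: "0 \<notin> universe M"
    and X: "finite X" "card X \<le> m" "d \<notin> X"
    and c: "c d \<in> {1..l}" "\<And>R ts. R \<in> syms V \<Longrightarrow> ts \<in> interp D R \<Longrightarrow> admissible k (map c ts)"
    and g: "colour_embedding V c D \<gamma> M X g"
  shows "\<exists>b\<in>universe M. colour_embedding V c D \<gamma> M (insert d X) (g(d := b))"
proof -
  have inj: "inj_on g X" and gX: "g ` X \<subseteq> universe M" and col: "\<And>x. x \<in> X \<Longrightarrow> \<gamma> (g x) = c x"
    and rel: "\<And>R ts. R \<in> syms V \<Longrightarrow> ts \<in> tuples X (arity V R) \<Longrightarrow>
      ts \<in> interp D R \<longleftrightarrow> map g ts \<in> interp M R"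
    using g by (auto simp: colour_embedding_def)
  have nz: "g x \<noteq> 0" if "x \<in> X" for x
    using gX zero that by (metis image_subset_iff)
  \<comment> \<open>Sends d to the placeholder 0. As 0 is not in \<open>universe M\<close>, the map
    stays injective, so a tuple can be recovered from its image in the pattern
    \<open>T\<close>.\<close>
  define g0 where "g0 = g(d := 0)"
  have inj0: "inj_on g0 (insert d X)"
    using inj nz X(3) by (auto simp: g0_def inj_on_def)
  have g0d: "g0 x = 0 \<longleftrightarrow> x = d" if "x \<in> insert d X" for x
    using nz that by (auto simp: g0_def)
  define T where "T = {(R, map g0 ts) | R ts. R \<in> syms V \<and> ts \<in> interp D R \<and>
    ts \<in> tuples (insert d X) (arity V R) \<and> d \<in> set ts}"
  have sub: "T \<subseteq> {(R, ts). R \<in> syms V \<and> ts \<in> tuples (insert 0 (g ` X)) (arity V R) \<and> 0 \<in> set ts \<and>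
                      admissible k (map (\<gamma>(0 := c d)) ts)}"
  proof (clarsimp simp: T_def, intro conjI)
    fix R ts assume ts: "R \<in> syms V" "ts \<in> interp D R" "ts \<in> tuples (insert d X) (arity V R)" "d \<in> set ts"
    show "map g0 ts \<in> tuples (insert 0 (g ` X)) (arity V R)"
      using ts(3) by (auto simp: tuples_def g0_def)
    show "0 \<in> g0 ` set ts" using ts(4) by (auto simp: g0_def image_iff)
    have "(\<gamma>(0 := c d)) (g0 x) = c x" if "x \<in> insert d X" for x
      using g0d[OF that] that col by (auto simp: g0_def)
    then have "map (\<gamma>(0 := c d) \<circ> g0) ts = map c ts"
      using ts(3) by (intro map_cong refl) (auto simp: tuples_def simp del: fun_upd_apply)
    then show "admissible k (map (\<gamma>(0 := c d) \<circ> g0) ts)"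
      using c(2)[OF ts(1,2)] by (simp only:)
  qed
  have card: "card (g ` X) \<le> m"
    using card_image_le[OF X(1), of g] X(2) by linarith
  obtain b where b: "b \<in> universe M" "b \<notin> g ` X" "\<gamma> b = c d"
    and T: "\<And>R ts. R \<in> syms V \<Longrightarrow> ts \<in> tuples (insert 0 (g ` X)) (arity V R) \<Longrightarrow> 0 \<in> set ts \<Longrightarrow>
      map (id(0 := b)) ts \<in> interp M R \<longleftrightarrow> (R, ts) \<in> T"
    by (rule genericE[OF gen gX card c(1) sub]) blast
  have "ts \<in> interp D R \<longleftrightarrow> map (g(d := b)) ts \<in> interp M R"
    if R: "R \<in> syms V" and ts: "ts \<in> tuples (insert d X) (arity V R)" for R ts
  proof (cases "d \<in> set ts")
    case False
    then have "map (g(d := b)) ts = map g ts" "ts \<in> tuples X (arity V R)"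
      using ts by (auto simp: tuples_def)
    then show ?thesis using rel[OF R] by metis
  next
    case True
    have "map (g(d := b)) ts = map (id(0 := b)) (map g0 ts)"
      using ts nz by (fastforce simp: tuples_def g0_def)
    moreover have "map g0 ts \<in> tuples (insert 0 (g ` X)) (arity V R)" "0 \<in> set (map g0 ts)"
      using ts True by (auto simp: tuples_def g0_def image_iff)
    ultimately have "map (g(d := b)) ts \<in> interp M R \<longleftrightarrow> (R, map g0 ts) \<in> T"
      using T[OF R] by metis
    also have "\<dots> \<longleftrightarrow> ts \<in> interp D R"
    proof
      assume "(R, map g0 ts) \<in> T"
      then obtain us where us: "map g0 ts = map g0 us" "us \<in> interp D R"
          "us \<in> tuples (insert d X) (arity V R)"
        unfolding T_def by blast
      moreover have "ts = us"
        using map_eq_on_iff_inj[OF inj0] us ts unfolding tuples_def by blast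
      ultimately show "ts \<in> interp D R" by simp
    qed (use R ts True in \<open>auto simp: T_def\<close>)
    finally show ?thesis by simp
  qed
  moreover have "inj_on (g(d := b)) (insert d X)" "\<forall>x\<in>insert d X. \<gamma> ((g(d := b)) x) = c x"
    using inj b X(3) col by (auto simp: inj_on_def)
  moreover have "(g(d := b)) ` insert d X \<subseteq> universe M"
    using gX b by auto
  ultimately show ?thesis
    using b(1) unfolding colour_embedding_def by blast
qed

lemma extend_colour_embedding:
  assumes gen: "generic k V l m \<gamma> M" and zero: "0 \<notin> universe M"
    and Y: "finite Y" "card Y \<le> m" "X \<subseteq> Y"
    and c: "\<And>y. y \<in> Y \<Longrightarrow> c y \<in> {1..l}"
      "\<And>R ts. R \<in> syms V \<Longrightarrow> ts \<in> interp D R \<Longrightarrow> admissible k (map c ts)"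
    and g: "colour_embedding V c D \<gamma> M X g"
  shows "\<exists>h. colour_embedding V c D \<gamma> M Y h \<and> (\<forall>x\<in>X. h x = g x)"
proof -
  have "finite Z \<Longrightarrow> Z \<subseteq> Y - X \<Longrightarrow>
    \<exists>h. colour_embedding V c D \<gamma> M (X \<union> Z) h \<and> (\<forall>x\<in>X. h x = g x)" for Z
  proof (induction Z rule: finite_induct)
    case empty
    then show ?case using g by auto
  next
    case (insert d Z)
    then obtain h where h: "colour_embedding V c D \<gamma> M (X \<union> Z) h" "\<forall>x\<in>X. h x = g x" by auto
    have "card (X \<union> Z) \<le> card Y" using insert Y by (intro card_mono) auto
    then have "\<exists>b\<in>universe M. colour_embedding V c D \<gamma> M (insert d (X \<union> Z)) (h(d := b))"
      using insert Y h by (intro extend_by_point[OF gen zero _ _ _ _ c(2)] c)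
        (auto intro: finite_subset)
    then show ?case using h(2) insert by (metis DiffD2 Un_insert_right fun_upd_other insert_subset)
  qed
  from this[of "Y - X"] show ?thesis using Y by (auto simp: Un_absorb1)
qed

section \<open>Back and forth between generic structures\<close>

text \<open>Quantifier rank, that is, nesting depth: the number of rounds of the game needed for the
  formula.\<close>

primrec quantifiers :: "'s form \<Rightarrow> nat" where
  "quantifiers Bot = 0"
| "quantifiers (Eq v w) = 0"
| "quantifiers (Atom R vs) = 0"
| "quantifiers (Imp p q) = max (quantifiers p) (quantifiers q)"
| "quantifiers (All v p) = Suc (quantifiers p)"

text \<open>An Ehrenfeucht-Fraisse argument. The sum of \<open>card W\<close> and the rank is the
  invariant: a quantifier costs one unit of rank and adds at most one variable to W, so the points
  in play never exceed the number that genericity can handle.\<close>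

lemma generic_equivalent:
  assumes "generic k V l m \<gamma> M" "(\<gamma>, M) \<in> coloured k V l n"
    and "generic k V l m \<gamma>' M'" "(\<gamma>', M') \<in> coloured k V l n'"
    and "form_of (colour_vocab V l) p" "fv p \<subseteq> W" "finite W" "card W + quantifiers p \<le> m"
    and "e ` W \<subseteq> universe M" "colour_embedding V \<gamma> M \<gamma>' M' (e ` W) g"
    and "\<And>v. v \<in> W \<Longrightarrow> e' v = g (e v)"
  shows "sat (expand \<gamma> M) e p \<longleftrightarrow> sat (expand \<gamma>' M') e' p"
  using assms
proof (induction p arbitrary: \<gamma> M n \<gamma>' M' n' W e e' g)
  case Bot
  then show ?case by simp
next
  case (Eq v w)
  then show ?case by (auto simp: colour_embedding_def inj_on_def)
next
  case (Atom R vs)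
  have *: "map e' vs = map g (map e vs)" and sub: "set (map e vs) \<subseteq> e ` W"
    using Atom by auto
  have emb: "colour_embedding V \<gamma> M \<gamma>' M' (e ` W) g" by fact
  show ?case
  proof (cases R)
    case (Inl Q)
    then have "Q \<in> syms V" "map e vs \<in> tuples (e ` W) (arity V Q)"
      using Atom.prems sub by (auto simp: tuples_def)
    then show ?thesis
      using emb Inl unfolding colour_embedding_def by (simp only: sat.simps expand_simps *)
  next
    case (Inr i)
    then obtain v where v: "vs = [v]" "v \<in> W"
      using Atom.prems by (auto simp: length_Suc_conv)
    then have "e v \<in> universe M" "e' v \<in> universe M'" "\<gamma>' (e' v) = \<gamma> (e v)"
      using Atom.prems emb by (auto simp: colour_embedding_def image_subset_iff)
    then show ?thesis using Inr v by simp
  qed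
next
  case (Imp p q)
  have "sat (expand \<gamma> M) e p \<longleftrightarrow> sat (expand \<gamma>' M') e' p"
    by (rule Imp.IH(1)[of _ _ n _ _ n' W _ g]) (use Imp.prems in auto)
  moreover have "sat (expand \<gamma> M) e q \<longleftrightarrow> sat (expand \<gamma>' M') e' q"
    by (rule Imp.IH(2)[of _ _ n _ _ n' W _ g]) (use Imp.prems in auto)
  ultimately show ?case by simp
next
  case (All v p)
  \<comment> \<open>Stated for an arbitrary pair of structures, so that it can be applied in both
    directions; the second use swaps the structures and inverts the partial isomorphism.\<close>
  have step: "\<exists>b\<in>universe N'. sat (expand \<delta> N) (i(v := a)) p \<longleftrightarrow> sat (expand \<delta>' N') (i'(v := b)) p"
    if N: "generic k V l m \<delta> N" "(\<delta>, N) \<in> coloured k V l r"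
      "generic k V l m \<delta>' N'" "(\<delta>', N') \<in> coloured k V l r'"
      "i ` (W - {v}) \<subseteq> universe N" "colour_embedding V \<delta> N \<delta>' N' (i ` (W - {v})) h"
      "\<And>w. w \<in> W - {v} \<Longrightarrow> i' w = h (i w)" and a: "a \<in> universe N"
    for \<delta> N r \<delta>' N' r' i i' h a
  proof -
    let ?X = "i ` (W - {v})"
    have card: "card (insert v W) + quantifiers p \<le> m"
      using All.prems(7,8) by (auto simp: card_insert_if)
    have cX: "card ?X \<le> m"
      using card_image_le[of "W - {v}" i] card_Diff_subset_Int[of W "{v}"] All.prems(7,8)
        card_mono[of W "W - {v}"] by auto
    have "\<exists>h'. colour_embedding V \<delta> N \<delta>' N' (insert a ?X) h' \<and> (\<forall>x\<in>?X. h' x = h x)"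
    proof (cases "a \<in> ?X")
      case True
      then show ?thesis using N(6) by (intro exI[of _ h]) (simp add: insert_absorb)
    next
      case False
      have "\<exists>b\<in>universe N'. colour_embedding V \<delta> N \<delta>' N' (insert a ?X) (h(a := b))"
        using N a False cX All.prems(7)
        by (intro extend_by_point[of k _ l m]) (auto simp: coloured_def colouring_def)
      then obtain b where "colour_embedding V \<delta> N \<delta>' N' (insert a ?X) (h(a := b))" by blast
      then show ?thesis using False by (intro exI[of _ "h(a := b)"]) auto
    qed
    then obtain h' where h': "colour_embedding V \<delta> N \<delta>' N' (insert a ?X) h'" "\<forall>x\<in>?X. h' x = h x"
      by blast
    have eqX: "(i(v := a)) ` insert v W = insert a ?X"
      by auto
    have "colour_embedding V \<delta> N \<delta>' N' ((i(v := a)) ` insert v W) h'"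
      unfolding eqX by (rule h'(1))
    moreover have "(i(v := a)) ` insert v W \<subseteq> universe N"
      unfolding eqX using N(5) a by blast
    ultimately have "sat (expand \<delta> N) (i(v := a)) p \<longleftrightarrow> sat (expand \<delta>' N') (i'(v := h' a)) p"
      using N(7) h'(2) All.prems(5-7) card
      by (intro All.IH[OF N(1-4), of "insert v W" _ h']) auto
    moreover have "h' a \<in> universe N'"
      using h'(1) by (auto simp: colour_embedding_def)
    ultimately show ?thesis by blast
  qed
  let ?g' = "inv_into (e ` (W - {v})) g"
  \<comment> \<open>The quantified variable v may itself belong to W. Its old value is about to be
    overwritten and must be dropped from the position first.\<close>
  have emb: "colour_embedding V \<gamma> M \<gamma>' M' (e ` (W - {v})) g"
    using All.prems(10) by (rule colour_embedding_mono) auto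
  then have inj: "inj_on g (e ` (W - {v}))"
    by (simp add: colour_embedding_def)
  have e': "e' ` (W - {v}) = g ` e ` (W - {v})"
    using All.prems(11) by (force simp: image_image)
  have emb': "colour_embedding V \<gamma>' M' \<gamma> M (e' ` (W - {v})) ?g'"
    unfolding e' using emb All.prems(9) by (intro colour_embedding_inv) auto
  have e_eq: "e w = ?g' (e' w)" if "w \<in> W - {v}" for w
    using All.prems(11) that inj by (simp add: inv_into_f_f)
  have "e' ` (W - {v}) \<subseteq> universe M'"
    unfolding e' using emb by (auto simp: colour_embedding_def)
  then have "\<exists>a\<in>universe M. sat (expand \<gamma>' M') (e'(v := b)) p \<longleftrightarrow> sat (expand \<gamma> M) (e(v := a)) p"
    if "b \<in> universe M'" for b
    using step[OF All.prems(3,4,1,2) _ emb' e_eq that] by blast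
  moreover have "\<exists>b\<in>universe M'. sat (expand \<gamma> M) (e(v := a)) p \<longleftrightarrow> sat (expand \<gamma>' M') (e'(v := b)) p"
    if "a \<in> universe M" for a
    using step[OF All.prems(1-4) _ emb _ that] All.prems(9,11) by blast
  ultimately show ?case by (simp) metis
qed

lemma generic_models_iff:
  assumes "generic k V l (quantifiers p) \<gamma> M" "(\<gamma>, M) \<in> coloured k V l n"
    and "generic k V l (quantifiers p) \<gamma>' M'" "(\<gamma>', M') \<in> coloured k V l n'"
    and "sentence (colour_vocab V l) p" "\<forall>R\<in>syms V. 2 \<le> arity V R"
  shows "models (expand \<gamma> M) p \<longleftrightarrow> models (expand \<gamma>' M') p"
proof -
  \<comment> \<open>The game starts from the empty map. There only the empty tuple could tell the
    structures apart, and arities of at least 2 exclude it.\<close>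
  have "sat (expand \<gamma> M) e p \<longleftrightarrow> sat (expand \<gamma>' M') e' p" for e e'
    by (rule generic_equivalent[OF assms(1-4), where W = "{}" and g = id])
      (use assms(5,6) in \<open>auto simp: sentence_def colour_embedding_def tuples_def\<close>)
  then show ?thesis unfolding models_def by blast
qed

section \<open>Counting non-generic structures\<close>

text \<open>In probabilistic terms: the traces of a uniformly random subset of A on disjoint blocks
  are independent, and each misses its prescribed value with probability 1 - 1 / 2^|D b|, which is
  at most 1 - 1 / 2^q. The induction splits E into its trace on one block and the rest.\<close>

lemma card_avoiding_blocks:
  assumes "finite Bs" "finite A"
    and "\<And>b. b \<in> Bs \<Longrightarrow> D b \<subseteq> A" "\<And>b. b \<in> Bs \<Longrightarrow> P b \<subseteq> D b" "\<And>b. b \<in> Bs \<Longrightarrow> card (D b) \<le> q"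
    and "\<And>b b'. b \<in> Bs \<Longrightarrow> b' \<in> Bs \<Longrightarrow> b \<noteq> b' \<Longrightarrow> D b \<inter> D b' = {}"
  shows "real (card {E \<in> Pow A. \<forall>b\<in>Bs. E \<inter> D b \<noteq> P b}) \<le> 2 ^ card A * (1 - 1 / 2 ^ q) ^ card Bs"
  using assms
proof (induction Bs arbitrary: A rule: finite_induct)
  case empty
  then show ?case using card_Pow[of A] by (simp add: Pow_def)
next
  case (insert b Bs)
  let ?S' = "{E \<in> Pow (A - D b). \<forall>b\<in>Bs. E \<inter> D b \<noteq> P b}"
  let ?h = "\<lambda>E. (E \<inter> D b, E - D b)"
  have Db: "D b \<subseteq> A" "P b \<subseteq> D b" "card (D b) \<le> q" using insert.prems by auto
  have fin: "finite (D b)" using Db insert.prems(1) finite_subset by blast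
  have "inj_on ?h {E \<in> Pow A. \<forall>b\<in>insert b Bs. E \<inter> D b \<noteq> P b}"
    by (rule inj_onI) blast
  moreover have "?h ` {E \<in> Pow A. \<forall>b\<in>insert b Bs. E \<inter> D b \<noteq> P b} \<subseteq> (Pow (D b) - {P b}) \<times> ?S'"
  proof (intro image_subsetI SigmaI)
    fix E assume E: "E \<in> {E \<in> Pow A. \<forall>b\<in>insert b Bs. E \<inter> D b \<noteq> P b}"
    then show "E \<inter> D b \<in> Pow (D b) - {P b}" by blast
    have "(E - D b) \<inter> D b' = E \<inter> D b'" if "b' \<in> Bs" for b'
      using insert.prems(5)[of b b'] insert.hyps that by blast
    then show "E - D b \<in> ?S'" using E by auto
  qed
  ultimately have "card {E \<in> Pow A. \<forall>b\<in>insert b Bs. E \<inter> D b \<noteq> P b} \<le> card ((Pow (D b) - {P b}) \<times> ?S')"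
    using fin insert.prems(1) by (intro card_inj_on_le) auto
  also have "\<dots> = (2 ^ card (D b) - 1) * card ?S'"
    using Db fin by (simp add: card_cartesian_product card_Diff_singleton card_Pow)
  finally have "real (card {E \<in> Pow A. \<forall>b\<in>insert b Bs. E \<inter> D b \<noteq> P b})
      \<le> real ((2 ^ card (D b) - 1) * card ?S')"
    by (rule of_nat_mono)
  also have "\<dots> = (2 ^ card (D b) - 1) * real (card ?S')"
    by (simp add: of_nat_diff)
  also have "\<dots> \<le> (2 ^ card (D b) * (1 - 1 / 2 ^ q)) * (2 ^ card (A - D b) * (1 - 1 / 2 ^ q) ^ card Bs)"
  proof (intro mult_mono)
    have "(2::real) ^ card (D b) \<le> 2 ^ q" using Db(3) by (intro power_increasing) auto
    then show "(2::real) ^ card (D b) - 1 \<le> 2 ^ card (D b) * (1 - 1 / 2 ^ q)"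
      by (simp add: field_simps)
    show "real (card ?S') \<le> 2 ^ card (A - D b) * (1 - 1 / 2 ^ q) ^ card Bs"
    proof (rule insert.IH)
      fix b' assume "b' \<in> Bs"
      then show "D b' \<subseteq> A - D b"
        using insert.prems(2)[of b'] insert.prems(5)[of b b'] insert.hyps by blast
    qed (use insert.prems in auto)
  qed auto
  also have "\<dots> = 2 ^ (card (D b) + card (A - D b)) * (1 - 1 / 2 ^ q) ^ card (insert b Bs)"
    using insert.hyps by (simp add: power_add)
  also have "card (D b) + card (A - D b) = card A"
    using Db(1) fin insert.prems(1) by (simp add: card_Diff_subset card_mono)
  finally show ?case .
qed

section \<open>Structures with a given colouring as sets of admissible tuples\<close>

definition edges :: "kind \<Rightarrow> 'r vocab \<Rightarrow> nat \<Rightarrow> (nat \<Rightarrow> nat) \<Rightarrow> ('r \<times> nat list) set" where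
  "edges k V n \<gamma> =
    {(R, ts). R \<in> syms V \<and> ts \<in> tuples {1..n} (arity V R) \<and> admissible k (map \<gamma> ts)}"

definition struct_of :: "nat \<Rightarrow> ('r \<times> nat list) set \<Rightarrow> ('r, nat) struct" where
  "struct_of n E = \<lparr>universe = {1..n}, interp = (\<lambda>R. {ts. (R, ts) \<in> E})\<rparr>"

lemma struct_of_simps [simp]:
  "universe (struct_of n E) = {1..n}" "ts \<in> interp (struct_of n E) R \<longleftrightarrow> (R, ts) \<in> E"
  by (simp_all add: struct_of_def)

text \<open>Admissibility is tested tuple by tuple, so for a fixed \<gamma> the structures form a
  full power set. This is the source of all independence in the counting.\<close>

lemma coloured_iff:
  "(\<gamma>, M) \<in> coloured k V l n \<longleftrightarrow>
     \<gamma> \<in> {1..n} \<rightarrow>\<^sub>E {1..l} \<and> M \<in> struct_of n ` Pow (edges k V n \<gamma>)"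
proof
  assume M: "(\<gamma>, M) \<in> coloured k V l n"
  have "{(R, ts). ts \<in> interp M R} \<subseteq> edges k V n \<gamma>"
  proof clarify
    fix R ts assume ts: "ts \<in> interp M R"
    have R: "R \<in> syms V"
      using M ts by (auto simp: coloured_def is_struct_def)
    moreover have "ts \<in> tuples {1..n} (arity V R)"
      using M is_struct_tuples[OF _ ts, of V] by (auto simp: coloured_def)
    moreover have "admissible k (map \<gamma> ts)"
      using M R ts unfolding coloured_def colouring_def by blast
    ultimately show "(R, ts) \<in> edges k V n \<gamma>" by (simp add: edges_def)
  qed
  moreover have "M = struct_of n {(R, ts). ts \<in> interp M R}"
    using M by (intro struct.equality) (auto simp: coloured_def struct_of_def)
  ultimately show "\<gamma> \<in> {1..n} \<rightarrow>\<^sub>E {1..l} \<and> M \<in> struct_of n ` Pow (edges k V n \<gamma>)"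
    using M by (auto simp: coloured_def colouring_def)
next
  assume "\<gamma> \<in> {1..n} \<rightarrow>\<^sub>E {1..l} \<and> M \<in> struct_of n ` Pow (edges k V n \<gamma>)"
  then show "(\<gamma>, M) \<in> coloured k V l n"
    by (auto simp: coloured_def colouring_def is_struct_def edges_def)
qed

lemma inj_struct_of: "inj (struct_of n)"
  by (rule inj_on_inverseI[of _ "\<lambda>M. {(R, ts). ts \<in> interp M R}"]) simp

lemma card_coloured_with:
  assumes "\<gamma> \<in> {1..n} \<rightarrow>\<^sub>E {1..l}"
  shows "card {M. (\<gamma>, M) \<in> coloured k V l n \<and> Q M} = card {E \<in> Pow (edges k V n \<gamma>). Q (struct_of n E)}"
proof -
  have "{M. (\<gamma>, M) \<in> coloured k V l n \<and> Q M} = struct_of n ` {E \<in> Pow (edges k V n \<gamma>). Q (struct_of n E)}"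
    using assms by (auto simp: coloured_iff)
  then show ?thesis
    by (simp add: card_image[OF inj_on_subset[OF inj_struct_of subset_UNIV]])
qed

lemma finite_tuples: "finite A \<Longrightarrow> finite (tuples A m)"
  unfolding tuples_def by (rule finite_lists_length_eq)

lemma card_tuples: "finite A \<Longrightarrow> card (tuples A m) = card A ^ m"
  unfolding tuples_def by (rule card_lists_length_eq)

lemma finite_edges: "finite (syms V) \<Longrightarrow> finite (edges k V n \<gamma>)"
  by (rule finite_subset[of _ "SIGMA R:syms V. tuples {1..n} (arity V R)"])
    (auto simp: edges_def intro: finite_tuples)

lemma finite_coloured:
  assumes "finite (syms V)"
  shows "finite (coloured k V l n)"
proof (rule finite_subset)
  show "coloured k V l n \<subseteq> (SIGMA \<gamma>:{1..n} \<rightarrow>\<^sub>E {1..l}. struct_of n ` Pow (edges k V n \<gamma>))"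
    using coloured_iff[of _ _ k V l n] by (intro subrelI SigmaI) simp_all
  show "finite (SIGMA \<gamma>:{1..n} \<rightarrow>\<^sub>E {1..l}. struct_of n ` Pow (edges k V n \<gamma>))"
    using finite_edges[OF assms] by (intro finite_SigmaI finite_imageI) (simp_all add: finite_PiE)
qed

text \<open>A set of at most m points consists of the nonzero entries of a list of length m over
  \<open>{0..n}\<close>, with 0 as padding; hence the base n + 1.\<close>

lemma card_small_subsets: "card {X. X \<subseteq> {1..n::nat} \<and> card X \<le> m} \<le> (n + 1) ^ m"
proof -
  have "{X. X \<subseteq> {1..n} \<and> card X \<le> m} \<subseteq> (\<lambda>xs. set xs - {0}) ` tuples {0..n} m"
  proof clarify
    fix X assume X: "X \<subseteq> {1..n}" "card X \<le> m"
    then have "finite X" using finite_subset by blast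
    then obtain xs where xs: "set xs = X" "length xs = card X"
      by (metis distinct_card finite_distinct_list)
    have "xs @ replicate (m - card X) 0 \<in> tuples {0..n} m"
      using X xs by (auto simp: tuples_def)
    moreover have "X = set (xs @ replicate (m - card X) 0) - {0}"
      using X(1) xs by auto
    ultimately show "X \<in> (\<lambda>xs. set xs - {0}) ` tuples {0..n} m" by blast
  qed
  then have "card {X. X \<subseteq> {1..n} \<and> card X \<le> m} \<le> card (tuples {0..n} m)"
    by (rule surj_card_le[rotated]) (simp add: finite_tuples)
  then show ?thesis by (simp add: card_tuples)
qed

section \<open>The union bound over one-point extension types\<close>

text \<open>Bounds the number of tuples on m old points and the placeholder, and so the size of
  every block.\<close>

definition block_size :: "'r vocab \<Rightarrow> nat \<Rightarrow> nat" where
  "block_size V m = (\<Sum>R\<in>syms V. (m + 1) ^ arity V R)"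

text \<open>The first factor counts base sets, colours and patterns. The second bounds the chance
  that one such type is realised nowhere: of at least r points of the right colour, at most m are
  lost to the base set. \<open>powr\<close> is used because r is real and r - m may be
  negative.\<close>

definition failure_bound :: "'r vocab \<Rightarrow> nat \<Rightarrow> nat \<Rightarrow> nat \<Rightarrow> real \<Rightarrow> real" where
  "failure_bound V l m n r =
    real ((n + 1) ^ m * l * 2 ^ block_size V m) * (1 - 1 / 2 ^ block_size V m) powr (r - real m)"

lemma block_size_pos: "finite (syms V) \<Longrightarrow> syms V \<noteq> {} \<Longrightarrow> 0 < block_size V m"
  unfolding block_size_def by (intro sum_pos) auto

definition patterns :: "kind \<Rightarrow> 'r vocab \<Rightarrow> (nat \<Rightarrow> nat) \<Rightarrow> nat set \<Rightarrow> nat \<Rightarrow> ('r \<times> nat list) set" where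
  "patterns k V \<gamma> X i = {(R, ts). R \<in> syms V \<and> ts \<in> tuples (insert 0 X) (arity V R) \<and> 0 \<in> set ts \<and>
     admissible k (map (\<gamma>(0 := i)) ts)}"

lemma card_patterns:
  assumes "finite (syms V)" "finite X" "card X \<le> m"
  shows "finite (patterns k V \<gamma> X i)" "card (patterns k V \<gamma> X i) \<le> block_size V m"
proof -
  let ?T = "SIGMA R:syms V. tuples (insert 0 X) (arity V R)"
  have sub: "patterns k V \<gamma> X i \<subseteq> ?T" by (auto simp: patterns_def)
  have fin: "finite ?T" using assms(1,2) by (intro finite_SigmaI finite_tuples) simp_all
  show "finite (patterns k V \<gamma> X i)" using sub fin finite_subset by blast
  have "card (insert 0 X) \<le> m + 1"
    using assms(2,3) by (simp add: card_insert_if)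
  then have "card ?T \<le> block_size V m"
    using assms unfolding block_size_def
    by (subst card_SigmaI) (auto simp: finite_tuples card_tuples intro!: sum_mono power_mono)
  then show "card (patterns k V \<gamma> X i) \<le> block_size V m"
    using card_mono[OF fin sub] by linarith
qed

text \<open>A union bound over base set X, colour i and pattern T. The candidates are the points b
  of colour i outside X, and the block of b is the pattern set with b in place of 0; the type fails
  exactly when no candidate has the trace prescribed by T.\<close>

lemma card_nongeneric:
  assumes V: "finite (syms V)" "syms V \<noteq> {}"
    and \<gamma>: "\<gamma> \<in> {1..n} \<rightarrow>\<^sub>E {1..l}"
    and rich: "\<And>i. i \<in> {1..l} \<Longrightarrow> r \<le> real (card {a \<in> {1..n}. \<gamma> a = i})"
  shows "real (card {E \<in> Pow (edges k V n \<gamma>). \<not> generic k V l m \<gamma> (struct_of n E)})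
    \<le> failure_bound V l m n r * 2 ^ card (edges k V n \<gamma>)"
proof -
  let ?q = "block_size V m"
  let ?\<rho> = "1 - 1 / 2 ^ ?q :: real"
  let ?N = "edges k V n \<gamma>"
  define \<phi> :: "nat \<Rightarrow> 'a \<times> nat list \<Rightarrow> 'a \<times> nat list"
    where "\<phi> b = map_prod id (map (id(0 := b)))" for b
  define Bs where "Bs X i = {b \<in> {1..n} - X. \<gamma> b = i}" for X i
  define fails where "fails X i T = {E \<in> Pow ?N. \<forall>b\<in>Bs X i. E \<inter> \<phi> b ` patterns k V \<gamma> X i \<noteq> \<phi> b ` T}" for X i T
  define small where "small = {X. X \<subseteq> {1..n} \<and> card X \<le> m}"
  define I where "I = (SIGMA p:small \<times> {1..l}. Pow (patterns k V \<gamma> (fst p) (snd p)))"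
  have finN: "finite ?N" by (rule finite_edges[OF V(1)])
  have fin_small: "finite X" "X \<subseteq> {1..n}" "card X \<le> m" if "X \<in> small" for X
    using that finite_subset unfolding small_def by blast+
  have pat: "finite (patterns k V \<gamma> X i)" "card (patterns k V \<gamma> X i) \<le> ?q" if "X \<in> small" for X i
    using card_patterns[OF V(1) fin_small(1,3)[OF that]] by auto
  have fsmall: "finite small" unfolding small_def by (rule finite_subset[of _ "Pow {1..n}"]) auto
  have \<rho>: "0 < ?\<rho>" "?\<rho> \<le> 1"
    using block_size_pos[OF V, of m] by (simp_all add: power_gt1_lemma)
  \<comment> \<open>Substituting a candidate of colour i for 0 leaves the colours of a tuple
    unchanged, so admissible patterns correspond to admissible tuples of the structure.\<close>
  have col: "map \<gamma> (map (id(0 := b)) ts) = map (\<gamma>(0 := i)) ts"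
    if "\<gamma> b = i" "0 \<notin> X" "set ts \<subseteq> insert 0 X" for b i ts X
    using that by auto
  have fails_le: "real (card (fails X i T)) \<le> 2 ^ card ?N * ?\<rho> powr (r - real m)"
    if X: "X \<in> small" and i: "i \<in> {1..l}" and T: "T \<subseteq> patterns k V \<gamma> X i" for X i T
  proof -
    have "real (card (fails X i T)) \<le> 2 ^ card ?N * ?\<rho> ^ card (Bs X i)"
      unfolding fails_def
    proof (rule card_avoiding_blocks)
      show "finite (Bs X i)" by (simp add: Bs_def)
      show "finite ?N" by (rule finN)
    next
      fix b assume b: "b \<in> Bs X i"
      show "\<phi> b ` patterns k V \<gamma> X i \<subseteq> ?N"
      proof clarify
        fix R ts R' ts' assume "(R', ts') = \<phi> b (R, ts)" and Rts: "(R, ts) \<in> patterns k V \<gamma> X i"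
        then have eq: "R' = R" "ts' = map (id(0 := b)) ts" by (auto simp: \<phi>_def)
        have "map \<gamma> ts' = map (\<gamma>(0 := i)) ts"
          unfolding eq using Rts b fin_small(2)[OF X]
          by (intro col[of _ _ X]) (auto simp: patterns_def tuples_def Bs_def)
        then have "admissible k (map \<gamma> ts')"
          using Rts by (simp add: patterns_def del: map_eq_conv)
        moreover have "ts' \<in> tuples {1..n} (arity V R)"
          unfolding eq using Rts b fin_small(2)[OF X] by (auto simp: patterns_def tuples_def Bs_def)
        ultimately show "(R', ts') \<in> ?N"
          using Rts eq by (simp add: edges_def patterns_def)
      qed
      show "\<phi> b ` T \<subseteq> \<phi> b ` patterns k V \<gamma> X i"
        using T by (rule image_mono)
      show "card (\<phi> b ` patterns k V \<gamma> X i) \<le> ?q"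
        using pat[OF X] card_image_le le_trans by blast
    next
      \<comment> \<open>Every tuple in the block of b contains b, and its other entries lie in X,
        which contains no candidate. Hence it is in no other block.\<close>
      fix b b' assume b: "b \<in> Bs X i" "b' \<in> Bs X i" "b \<noteq> b'"
      show "\<phi> b ` patterns k V \<gamma> X i \<inter> \<phi> b' ` patterns k V \<gamma> X i = {}"
      proof (rule ccontr)
        assume "\<phi> b ` patterns k V \<gamma> X i \<inter> \<phi> b' ` patterns k V \<gamma> X i \<noteq> {}"
        then obtain R ts ts' where ts: "(R, ts) \<in> patterns k V \<gamma> X i" "(R, ts') \<in> patterns k V \<gamma> X i"
          and eq: "map (id(0 := b)) ts = map (id(0 := b')) ts'"
          by (auto simp: \<phi>_def simp del: map_eq_conv)
        have "b \<in> set (map (id(0 := b)) ts)" using ts(1) by (force simp: patterns_def)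
        moreover have "set (map (id(0 := b')) ts') \<subseteq> insert b' X"
          using ts(2) by (auto simp: patterns_def tuples_def)
        ultimately have "b \<in> insert b' X" unfolding eq by blast
        then show False using b by (auto simp: Bs_def)
      qed
    qed
    \<comment> \<open>The base is at most 1, so a lower bound on the number of candidates gives an
      upper bound on the power.\<close>
    also have "?\<rho> ^ card (Bs X i) \<le> ?\<rho> powr (r - real m)"
    proof -
      have "Bs X i = {a \<in> {1..n}. \<gamma> a = i} - X" by (auto simp: Bs_def)
      then have "card {a \<in> {1..n}. \<gamma> a = i} - card X \<le> card (Bs X i)"
        using diff_card_le_card_Diff[OF fin_small(1)[OF X]] by simp
      then have "r - real m \<le> real (card (Bs X i))"
        using rich[OF i] fin_small(3)[OF X] by linarith
      then show ?thesis
        using \<rho> by (subst powr_realpow[symmetric]) (auto intro: powr_mono')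
    qed
    finally show ?thesis by simp
  qed
  have "{E \<in> Pow ?N. \<not> generic k V l m \<gamma> (struct_of n E)} \<subseteq> (\<Union>((X, i), T)\<in>I. fails X i T)"
  proof clarify
    fix E assume E: "E \<subseteq> ?N" and "\<not> generic k V l m \<gamma> (struct_of n E)"
    then obtain X i T where X: "X \<in> small" and i: "i \<in> {1..l}" and T: "T \<subseteq> patterns k V \<gamma> X i"
      and no: "\<And>b. b \<in> {1..n} - X \<Longrightarrow> \<gamma> b = i \<Longrightarrow>
        \<exists>R\<in>syms V. \<exists>ts\<in>tuples (insert 0 X) (arity V R). 0 \<in> set ts \<and>
            ((R, map (id(0 := b)) ts) \<in> E \<longleftrightarrow> (R, ts) \<notin> T)"
      unfolding generic_def patterns_def[symmetric] small_def by (auto 0 3)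
    have "E \<inter> \<phi> b ` patterns k V \<gamma> X i \<noteq> \<phi> b ` T" if "b \<in> Bs X i" for b
    proof
      assume eq: "E \<inter> \<phi> b ` patterns k V \<gamma> X i = \<phi> b ` T"
      have b: "b \<in> {1..n} - X" "\<gamma> b = i" using that by (auto simp: Bs_def)
      obtain R ts where R: "R \<in> syms V" and ts: "ts \<in> tuples (insert 0 X) (arity V R)" "0 \<in> set ts"
        and ne: "(R, map (id(0 := b)) ts) \<in> E \<longleftrightarrow> (R, ts) \<notin> T"
        using no[OF b] by blast
      have \<phi>: "\<phi> b (R, ts) = (R, map (id(0 := b)) ts)" by (simp add: \<phi>_def)
      have inj: "inj_on (id(0 := b)) (insert 0 X)"
        using b(1) by (auto simp: inj_on_def)
      show False
      proof (cases "(R, ts) \<in> T")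
        case True
        then show False using eq ne \<phi> by (metis Int_iff image_eqI)
      next
        case False
        \<comment> \<open>A tuple present in E although T omits it must be admissible, hence belongs
          to the pattern set, where the trace prescribed by T forbids it.\<close>
        then have inE: "(R, map (id(0 := b)) ts) \<in> E" using ne by simp
        then have "admissible k (map \<gamma> (map (id(0 := b)) ts))"
          using E by (auto simp: edges_def)
        moreover have "map \<gamma> (map (id(0 := b)) ts) = map (\<gamma>(0 := i)) ts"
          using ts b fin_small(2)[OF X] by (intro col[of _ _ X]) (auto simp: tuples_def)
        ultimately have "(R, ts) \<in> patterns k V \<gamma> X i"
          using R ts unfolding patterns_def by (simp del: map_map)
        then have "\<phi> b (R, ts) \<in> \<phi> b ` T"
          using inE eq \<phi> by (metis Int_iff image_eqI)
        then obtain us where us: "(R, us) \<in> T" "map (id(0 := b)) us = map (id(0 := b)) ts"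
          by (auto simp: \<phi>_def simp del: map_eq_conv)
        then have "us = ts"
          using T ts map_eq_on_iff_inj[OF inj, of us ts]
          by (auto simp: patterns_def tuples_def simp del: map_eq_conv)
        then show False using us(1) False by simp
      qed
    qed
    then have "E \<in> fails X i T" using E by (auto simp: fails_def)
    moreover have "((X, i), T) \<in> I" using X i T by (auto simp: I_def)
    ultimately show "E \<in> (\<Union>((X, i), T)\<in>I. fails X i T)"
      by (intro UN_I[of "((X, i), T)"]) simp_all
  qed
  moreover have finI: "finite I"
    unfolding I_def using fsmall pat by (intro finite_SigmaI) auto
  moreover have "finite (\<Union>((X, i), T)\<in>I. fails X i T)"
    by (rule finite_subset[of _ "Pow ?N"]) (auto simp: fails_def finN)
  ultimately have "card {E \<in> Pow ?N. \<not> generic k V l m \<gamma> (struct_of n E)}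
      \<le> card (\<Union>((X, i), T)\<in>I. fails X i T)"
    by (intro card_mono)
  also have "\<dots> \<le> (\<Sum>((X, i), T)\<in>I. card (fails X i T))"
    using card_UN_le[OF finI, of "\<lambda>((X, i), T). fails X i T"] by (simp add: case_prod_beta)
  finally have "real (card {E \<in> Pow ?N. \<not> generic k V l m \<gamma> (struct_of n E)})
      \<le> (\<Sum>((X, i), T)\<in>I. real (card (fails X i T)))"
    by (simp add: case_prod_beta flip: of_nat_sum)
  also have "\<dots> \<le> (\<Sum>p\<in>I. 2 ^ card ?N * ?\<rho> powr (r - real m))"
    by (rule sum_mono) (auto simp: I_def simp del: One_nat_def intro!: fails_le)
  also have "\<dots> = real (card I) * (2 ^ card ?N * ?\<rho> powr (r - real m))"
    by simp
  also have "\<dots> \<le> real ((n + 1) ^ m * l * 2 ^ ?q) * (2 ^ card ?N * ?\<rho> powr (r - real m))"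
  proof (intro mult_right_mono of_nat_mono)
    have "card I = (\<Sum>p\<in>small \<times> {1..l}. card (Pow (patterns k V \<gamma> (fst p) (snd p))))"
      unfolding I_def using fsmall pat by (intro card_SigmaI) auto
    also have "\<dots> \<le> (\<Sum>p\<in>small \<times> {1..l}. 2 ^ ?q)"
      using pat
      by (intro sum_mono) (auto simp: card_Pow intro!: power_increasing)
    also have "\<dots> = card small * l * 2 ^ ?q" by (simp add: card_cartesian_product)
    also have "\<dots> \<le> (n + 1) ^ m * l * 2 ^ ?q"
      using card_small_subsets unfolding small_def by (intro mult_right_mono) auto
    finally show "card I \<le> (n + 1) ^ m * l * 2 ^ ?q" .
  qed simp
  finally show ?thesis by (simp add: failure_bound_def mult_ac)
qed

text \<open>On the fixed universe richness depends on \<gamma> alone, and the failure fraction is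
  the same for every rich \<gamma>. Summing over these colourings therefore preserves it, however
  unequal the numbers of structures they carry.\<close>

lemma card_rich_nongeneric:
  assumes V: "finite (syms V)" "syms V \<noteq> {}"
  shows "real (card {(\<gamma>, M) \<in> coloured k V l n. rich l r \<gamma> M \<and> \<not> generic k V l m \<gamma> M})
    \<le> failure_bound V l m n r * real (card {(\<gamma>, M) \<in> coloured k V l n. rich l r \<gamma> M})"
proof -
  define \<Gamma> where "\<Gamma> = {\<gamma> \<in> {1..n} \<rightarrow>\<^sub>E {1..l}. \<forall>i\<in>{1..l}. r \<le> real (card {a \<in> {1..n}. \<gamma> a = i})}"
  have fin\<Gamma>: "finite \<Gamma>" unfolding \<Gamma>_def by (simp add: finite_PiE)
  have fin: "finite {M. (\<gamma>, M) \<in> coloured k V l n \<and> Q M}" for \<gamma> Q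
    by (rule finite_subset[of _ "snd ` coloured k V l n"])
      (force intro: finite_imageI finite_coloured[OF V(1)])+
  have *: "card {(\<gamma>, M) \<in> coloured k V l n. rich l r \<gamma> M \<and> Q \<gamma> M} =
      (\<Sum>\<gamma>\<in>\<Gamma>. card {E \<in> Pow (edges k V n \<gamma>). Q \<gamma> (struct_of n E)})" for Q
  proof -
    have "{(\<gamma>, M) \<in> coloured k V l n. rich l r \<gamma> M \<and> Q \<gamma> M} =
        (SIGMA \<gamma>:\<Gamma>. {M. (\<gamma>, M) \<in> coloured k V l n \<and> Q \<gamma> M})"
      by (auto simp: \<Gamma>_def rich_def coloured_iff)
    then have "card {(\<gamma>, M) \<in> coloured k V l n. rich l r \<gamma> M \<and> Q \<gamma> M} =
        (\<Sum>\<gamma>\<in>\<Gamma>. card {M. (\<gamma>, M) \<in> coloured k V l n \<and> Q \<gamma> M})"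
      using fin\<Gamma> fin by (simp add: card_SigmaI)
    also have "\<dots> = (\<Sum>\<gamma>\<in>\<Gamma>. card {E \<in> Pow (edges k V n \<gamma>). Q \<gamma> (struct_of n E)})"
      by (intro sum.cong refl card_coloured_with) (simp add: \<Gamma>_def)
    finally show ?thesis .
  qed
  have "real (card {(\<gamma>, M) \<in> coloured k V l n. rich l r \<gamma> M \<and> \<not> generic k V l m \<gamma> M}) =
      (\<Sum>\<gamma>\<in>\<Gamma>. real (card {E \<in> Pow (edges k V n \<gamma>). \<not> generic k V l m \<gamma> (struct_of n E)}))"
    by (subst *) simp
  also have "\<dots> \<le> (\<Sum>\<gamma>\<in>\<Gamma>. failure_bound V l m n r * 2 ^ card (edges k V n \<gamma>))"
    by (intro sum_mono card_nongeneric[OF V]) (auto simp: \<Gamma>_def)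
  also have "\<dots> = failure_bound V l m n r * (\<Sum>\<gamma>\<in>\<Gamma>. 2 ^ card (edges k V n \<gamma>))"
    by (simp add: sum_distrib_left)
  also have "(\<Sum>\<gamma>\<in>\<Gamma>. 2 ^ card (edges k V n \<gamma>)) = real (card {(\<gamma>, M) \<in> coloured k V l n. rich l r \<gamma> M})"
    using *[of "\<lambda>_ _. True"] finite_edges[OF V(1)] by (simp add: card_Pow flip: Pow_def)
  finally show ?thesis .
qed

lemma failure_bound_tendsto:
  assumes V: "finite (syms V)" "syms V \<noteq> {}"
    and f: "filterlim (\<lambda>n. f n / ln (real n)) at_top sequentially"
  shows "(\<lambda>n. failure_bound V l m n (f n)) \<longlonglongrightarrow> 0"
proof -
  define \<rho> :: real where "\<rho> = 1 - 1 / 2 ^ block_size V m"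
  define C where "C = real (l * 2 ^ block_size V m) * \<rho> powr (- real m)"
  have \<rho>: "0 < \<rho>" "\<rho> < 1"
    using block_size_pos[OF V, of m] by (simp_all add: \<rho>_def power_gt1_lemma)
  then have ln\<rho>: "ln \<rho> < 0" by simp
  \<comment> \<open>For n > 1 this says that \<open>\<rho> powr f n\<close> is at most
    \<open>n powr - (m + 1)\<close>: one power of n beyond what cancels \<open>(n + 1) ^ m\<close>.
    The shift by m in the exponent goes into the constant \<open>C\<close>.\<close>
  have "eventually (\<lambda>n. (real m + 1) / - ln \<rho> \<le> f n / ln (real n)) sequentially"
    using f by (simp add: filterlim_at_top)
  then have ev: "eventually (\<lambda>n. failure_bound V l m n (f n) \<le>
      C * ((real n + 1) ^ m / real n powr (real m + 1))) sequentially"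
    using eventually_gt_at_top[of 1]
  proof eventually_elim
    case (elim n)
    then have "0 < ln (real n)" by simp
    then have "(real m + 1) * ln (real n) \<le> f n * - ln \<rho>"
      using elim(1) ln\<rho> by (simp add: divide_simps mult_ac split: if_splits)
    then have "\<rho> powr f n \<le> real n powr - (real m + 1)"
      using \<rho> elim(2) by (simp add: powr_def algebra_simps)
    then have "\<rho> powr (f n - real m) \<le> \<rho> powr (- real m) * real n powr - (real m + 1)"
      unfolding diff_conv_add_uminus powr_add
      by (subst mult.commute, intro mult_left_mono) auto
    then have "failure_bound V l m n (f n) \<le>
        real ((n + 1) ^ m * l * 2 ^ block_size V m) * (\<rho> powr (- real m) * real n powr - (real m + 1))"
      unfolding failure_bound_def \<rho>_def[symmetric] by (intro mult_left_mono) auto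
    also have "\<dots> = C * ((real n + 1) ^ m / real n powr (real m + 1))"
      unfolding powr_minus[of "real n"] by (simp add: C_def divide_inverse add.commute)
    finally show ?case .
  qed
  have "(\<lambda>n. (real n + 1) ^ m / real n powr (real m + 1)) \<longlonglongrightarrow> 0"
  proof (rule Lim_transform_eventually)
    have "(\<lambda>n. (1 + 1 / real n) ^ m * (1 / real n)) \<longlonglongrightarrow> (1 + 0) ^ m * 0"
      by (intro tendsto_intros lim_1_over_n)
    then show "(\<lambda>n. (1 + 1 / real n) ^ m * (1 / real n)) \<longlonglongrightarrow> 0" by simp
    show "\<forall>\<^sub>F n in sequentially. (1 + 1 / real n) ^ m * (1 / real n) =
        (real n + 1) ^ m / real n powr (real m + 1)"
      using eventually_gt_at_top[of 0]
    proof eventually_elim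
      case (elim n)
      then have "(1 + 1 / real n) ^ m = (real n + 1) ^ m / real n ^ m"
        by (simp add: field_simps flip: power_divide)
      then show ?case using elim by (simp add: powr_add powr_realpow)
    qed
  qed
  then have "(\<lambda>n. C * ((real n + 1) ^ m / real n powr (real m + 1))) \<longlonglongrightarrow> C * 0"
    by (rule tendsto_mult_left)
  then show ?thesis
    by (intro tendsto_sandwich[OF _ ev tendsto_const]) (auto simp: failure_bound_def)
qed

section \<open>Uniqueness of generic colourings\<close>

text \<open>With arities of at least 2, no relation holds inside a monochromatic set. So all pairs
  of distinct points of one colour look alike and can serve as the starting position of an
  extension.\<close>

lemma not_admissible_constant:
  assumes "2 \<le> length cs" "\<And>c. c \<in> set cs \<Longrightarrow> c = i"
  shows "\<not> admissible k cs"
proof -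
  have *: "cs ! j = i" if "j < length cs" for j
    using assms(2) that nth_mem by blast
  show ?thesis
  proof (cases k)
    case Plain
    then show ?thesis using * by auto
  next
    case Strong
    show ?thesis
    proof
      assume "admissible k cs"
      then have "cs ! 0 \<noteq> cs ! 1"
        using assms(1) unfolding Strong admissible.simps by (metis One_nat_def Suc_1 Suc_le_lessD less_trans zero_less_one zero_neq_one)
      moreover have "cs \<noteq> []" using assms(1) by auto
      ultimately show False using *[of 0] *[of 1] assms(1) by auto
    qed
  qed
qed

lemma colouring_pullback:
  assumes h: "embedding V h D M" and D: "is_struct V D" and col: "colouring k V l \<gamma> M"
  shows "colouring k V l (restrict (\<lambda>x. \<gamma> (h x)) (universe D)) D"
proof -
  have "admissible k (map (restrict (\<lambda>x. \<gamma> (h x)) (universe D)) ts)"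
    if "R \<in> syms V" "ts \<in> interp D R" for R ts
  proof -
    have "map h ts \<in> interp M R"
      using h is_struct_tuples[OF D that(2)] that unfolding embedding_def by blast
    then have "admissible k (map \<gamma> (map h ts))"
      using col that unfolding colouring_def by blast
    moreover have "map (restrict (\<lambda>x. \<gamma> (h x)) (universe D)) ts = map \<gamma> (map h ts)"
      using is_struct_set[OF D that(2)] by auto
    ultimately show ?thesis by (simp only:)
  qed
  moreover have "\<gamma> (h x) \<in> {1..l}" if "x \<in> universe D" for x
    using h col that unfolding embedding_def colouring_def by blast
  ultimately show ?thesis unfolding colouring_def by auto
qed

lemma colour_embedding_imp_embedding:
  "colour_embedding V c D \<gamma> M (universe D) h \<Longrightarrow> embedding V h D M"
  by (simp add: colour_embedding_def embedding_def)

lemma colouredD: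
  assumes "(\<gamma>, M) \<in> coloured k V l n"
  shows "is_struct V M" "universe M = {1..n}" "colouring k V l \<gamma> M"
  using assms by (auto simp: coloured_def)

lemma CC_D:
  assumes "M \<in> CC k V l n"
  shows "is_struct V M" "universe M = {1..n}"
proof -
  obtain \<gamma> where "(\<gamma>, M) \<in> coloured k V l n"
    using assms unfolding CC_eq by force
  then show "is_struct V M" "universe M = {1..n}"
    using colouredD by blast+
qed

lemma colouring_range: "colouring k V l \<gamma> M \<Longrightarrow> a \<in> universe M \<Longrightarrow> \<gamma> a \<in> {1..l}"
  unfolding colouring_def by blast

text \<open>Colour S so that s - 1 and s receive the common colour of a and b. Both pairs are
  monochromatic, hence free of relations, so sending one to the other is a partial colour-preserving
  isomorphism, and genericity extends it to S.\<close>

lemma generic_same_colour: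
  assumes S: "xi_structure k V l S" "universe S = {1..s}" "s \<le> m"
    and M: "generic k V l m \<gamma> M" "(\<gamma>, M) \<in> coloured k V l n"
    and ar: "\<forall>R\<in>syms V. 2 \<le> arity V R"
    and ab: "a \<in> universe M" "b \<in> universe M" "\<gamma> a = \<gamma> b" "a \<noteq> b"
  shows "\<exists>h. embedding V h S M \<and> h (s - 1) = a \<and> h s = b"
proof -
  note M' = colouredD[OF M(2)]
  obtain t where t: "3 \<le> t" "universe S = {1..t}"
      "\<And>i. i \<in> {1..l} \<Longrightarrow> \<exists>\<gamma>. colouring k V l \<gamma> S \<and> \<gamma> (t - 1) = i \<and> \<gamma> t = i"
    using S(1) unfolding xi_structure_def by blast
  have "card (universe S) = t" "card (universe S) = s"
    by (simp add: t(2), simp add: S(2))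
  then have "t = s" by simp
  then obtain c where c: "colouring k V l c S" "c (s - 1) = \<gamma> a" "c s = \<gamma> a"
    using t(3)[of "\<gamma> a"] colouring_range[OF M'(3) ab(1)] by auto
  have s: "3 \<le> s" "1 \<le> s - 1" using t(1) \<open>t = s\<close> by simp_all
  define g where "g = (\<lambda>x. if x = s then b else a)"
  have "colour_embedding V c S \<gamma> M {s - 1, s} g"
    unfolding colour_embedding_def
  proof (intro conjI ballI)
    show "inj_on g {s - 1, s}" "g ` {s - 1, s} \<subseteq> universe M"
      using ab s by (auto simp: g_def inj_on_def)
    fix x assume "x \<in> {s - 1, s}"
    then show "\<gamma> (g x) = c x" using ab c s by (auto simp: g_def)
  next
    fix R ts assume R: "R \<in> syms V" and ts: "ts \<in> tuples {s - 1, s} (arity V R)"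
    have len: "2 \<le> length ts" using ar R ts by (auto simp: tuples_def)
    have "\<not> admissible k (map c ts)"
      using len ts c by (intro not_admissible_constant[of _ "\<gamma> a"]) (auto simp: tuples_def)
    moreover have "\<not> admissible k (map \<gamma> (map g ts))"
      using len ts ab by (intro not_admissible_constant[of _ "\<gamma> a"]) (auto simp: tuples_def g_def)
    ultimately show "ts \<in> interp S R \<longleftrightarrow> map g ts \<in> interp M R"
      using c(1) M'(3) R unfolding colouring_def by blast
  qed
  moreover have "\<And>R ts. R \<in> syms V \<Longrightarrow> ts \<in> interp S R \<Longrightarrow> admissible k (map c ts)"
    using c(1) unfolding colouring_def by blast
  moreover have "\<And>y. y \<in> {1..s} \<Longrightarrow> c y \<in> {1..l}"
    using colouring_range[OF c(1)] S(2) by blast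
  moreover have "0 \<notin> universe M" "card {1..s} \<le> m" "{s - 1, s} \<subseteq> {1..s}"
    using M'(2) s S(3) by auto
  ultimately obtain h where h: "colour_embedding V c S \<gamma> M {1..s} h" "\<forall>x\<in>{s - 1, s}. h x = g x"
    using extend_colour_embedding[OF M(1), of "{1..s}" "{s - 1, s}" c S g] by blast
  then show ?thesis
    using colour_embedding_imp_embedding[of V c S] S(2) s
    by (intro exI[of _ h]) (auto simp: g_def)
qed

text \<open>Any colouring of M, generic or not, pulls back along h to a colouring of S, which must
  identify the colours of s - 1 and s.\<close>

lemma same_colour_if_embedding:
  assumes S: "xi_structure k V l S" "universe S = {1..s}"
    and h: "embedding V h S M" and \<gamma>: "colouring k V l \<gamma> M"
  shows "\<gamma> (h (s - 1)) = \<gamma> (h s)"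
proof -
  obtain t where t: "3 \<le> t" "universe S = {1..t}" "is_struct V S"
      "\<And>\<gamma>. colouring k V l \<gamma> S \<Longrightarrow> \<gamma> (t - 1) = \<gamma> t"
    using S(1) unfolding xi_structure_def by blast
  have "card (universe S) = t" "card (universe S) = s"
    by (simp add: t(2), simp add: S(2))
  then have "t = s" by simp
  moreover have "1 \<le> s - 1" using t(1) \<open>t = s\<close> by simp
  ultimately show ?thesis
    using t(4)[OF colouring_pullback[OF h t(3) \<gamma>]] t(1,2) by auto
qed

section \<open>Existence of a structure S defining equality of colours\<close>

text \<open>The complete \<open>r\<close>-uniform hypergraph on \<open>Y\<close>: when \<open>Y\<close> has \<open>l * q\<close> elements, an admissible
  colouring with \<open>l\<close> colours must use every colour exactly \<open>q\<close> times.\<close>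

lemma clique_colouring_iff:
  assumes "finite Y"
    and "k = Plain \<and> r = Suc q \<or> k = Strong \<and> q = 1 \<and> 2 \<le> r \<and> r \<le> card Y"
  shows "(\<forall>ts. length ts = r \<and> distinct ts \<and> set ts \<subseteq> Y \<longrightarrow> admissible k (map \<gamma> ts)) \<longleftrightarrow>
     (\<forall>i. card {y \<in> Y. \<gamma> y = i} \<le> q)"
  using assms(2)
proof (elim disjE conjE)
  assume k: "k = Plain" "r = Suc q"
  show ?thesis
  proof (intro iffI allI impI)
    fix i assume *: "\<forall>ts. length ts = r \<and> distinct ts \<and> set ts \<subseteq> Y \<longrightarrow> admissible k (map \<gamma> ts)"
    show "card {y \<in> Y. \<gamma> y = i} \<le> q"
    proof (rule ccontr)
      assume "\<not> ?thesis"
      then have "r \<le> card {y \<in> Y. \<gamma> y = i}" using k by simp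
      then obtain Z where Z: "Z \<subseteq> {y \<in> Y. \<gamma> y = i}" "card Z = r" "finite Z"
        by (rule obtain_subset_with_card_n)
      then obtain ts where ts: "set ts = Z" "distinct ts" "length ts = r"
        by (metis distinct_card finite_distinct_list)
      then have "admissible k (map \<gamma> ts)" using * Z by blast
      then obtain a b where ab: "a < length ts" "b < length ts" "\<gamma> (ts ! a) \<noteq> \<gamma> (ts ! b)"
        using k by auto
      have "\<gamma> (ts ! j) = i" if "j < length ts" for j
        using Z(1) ts(1) nth_mem[OF that] by blast
      then show False using ab by simp
    qed
  next
    fix ts assume *: "\<forall>i. card {y \<in> Y. \<gamma> y = i} \<le> q"
      and ts: "length ts = r \<and> distinct ts \<and> set ts \<subseteq> Y"
    show "admissible k (map \<gamma> ts)"
    proof (rule ccontr)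
      assume no: "\<not> ?thesis"
      have "\<gamma> (ts ! a) = \<gamma> (ts ! 0)" if a: "a < length ts" for a
      proof -
        have "0 < length (map \<gamma> ts)" "a < length (map \<gamma> ts)" using a by auto
        then have "map \<gamma> ts ! a = map \<gamma> ts ! 0"
          using no unfolding k(1) admissible.simps by blast
        moreover have "0 < length ts" using a by auto
        ultimately show ?thesis using a by simp
      qed
      then have "set ts \<subseteq> {y \<in> Y. \<gamma> y = \<gamma> (ts ! 0)}"
        using ts by (auto simp: in_set_conv_nth)
      then have "card (set ts) \<le> q"
        using *[rule_format, of "\<gamma> (ts ! 0)"]
          card_mono[of "{y \<in> Y. \<gamma> y = \<gamma> (ts ! 0)}" "set ts"] assms(1) by simp
      then show False using ts k distinct_card by fastforce
    qed
  qed
next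
  assume k: "k = Strong" "q = 1" "2 \<le> r" "r \<le> card Y"
  show ?thesis
  proof (intro iffI allI impI)
    fix i assume *: "\<forall>ts. length ts = r \<and> distinct ts \<and> set ts \<subseteq> Y \<longrightarrow> admissible k (map \<gamma> ts)"
    show "card {y \<in> Y. \<gamma> y = i} \<le> q"
    proof (rule ccontr)
      assume "\<not> ?thesis"
      then have "2 \<le> card {y \<in> Y. \<gamma> y = i}" using k by simp
      then obtain P where P: "P \<subseteq> {y \<in> Y. \<gamma> y = i}" "card P = 2" "finite P"
        by (rule obtain_subset_with_card_n)
      then obtain y y' where y: "P = {y, y'}" "y \<noteq> y'"
        by (auto simp: card_2_iff)
      \<comment> \<open>Since r is at most \<open>card Y\<close>, two equally coloured vertices can
        be completed to the vertex set of an edge, which then violates strong admissibility.\<close>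
      obtain Z where Z: "P \<subseteq> Z" "Z \<subseteq> Y" "card Z = r"
        using exists_subset_between[of P r Y] P k assms(1) by auto
      then obtain ts where ts: "set ts = Z" "distinct ts" "length ts = r"
        using finite_subset[OF Z(2) assms(1)] by (metis distinct_card finite_distinct_list)
      then have "admissible k (map \<gamma> ts)" using * Z by blast
      moreover obtain a b where "a < length ts" "ts ! a = y" "b < length ts" "ts ! b = y'"
        using y Z ts by (metis in_set_conv_nth insert_subset)
      ultimately have "\<gamma> y \<noteq> \<gamma> y'"
        using k y(2) by auto
      then show False using P(1) y(1) by auto
    qed
  next
    fix ts assume *: "\<forall>i. card {y \<in> Y. \<gamma> y = i} \<le> q"
      and ts: "length ts = r \<and> distinct ts \<and> set ts \<subseteq> Y"
    have "\<gamma> (ts ! a) \<noteq> \<gamma> (ts ! b)" if "a < length ts" "b < length ts" "a \<noteq> b" for a b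
    proof
      assume eq: "\<gamma> (ts ! a) = \<gamma> (ts ! b)"
      have ne: "ts ! a \<noteq> ts ! b" using ts that nth_eq_iff_index_eq by blast
      have "{ts ! a, ts ! b} \<subseteq> {y \<in> Y. \<gamma> y = \<gamma> (ts ! a)}"
        using ts that eq nth_mem by auto
      then have "card {ts ! a, ts ! b} \<le> card {y \<in> Y. \<gamma> y = \<gamma> (ts ! a)}"
        using assms(1) by (intro card_mono) auto
      also have "\<dots> \<le> q" using * by blast
      finally show False using ne k by simp
    qed
    then show "admissible k (map \<gamma> ts)" using k by simp
  qed
qed

text \<open>Pigeonhole: l classes of size at most q can exhaust l q points only if all of them are
  full.\<close>

lemma card_colour_class_eq:
  assumes "finite Y" "card Y = l * q" "\<gamma> ` Y \<subseteq> {1..l}"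
    and le: "\<And>i. card {y \<in> Y. \<gamma> y = i} \<le> q" and i: "i \<in> {1..l::nat}"
  shows "card {y \<in> Y. \<gamma> y = i} = q"
proof (rule ccontr)
  assume "card {y \<in> Y. \<gamma> y = i} \<noteq> q"
  then have "card {y \<in> Y. \<gamma> y = i} < q" using le[of i] by simp
  then have "(\<Sum>j\<in>{1..l}. card {y \<in> Y. \<gamma> y = j}) < (\<Sum>j\<in>{1..l}. q)"
    using i le by (intro sum_strict_mono_ex1) auto
  moreover have "(\<Sum>j\<in>{1..l}. card {y \<in> Y. \<gamma> y = j}) = card Y"
    using sum.group[OF assms(1) _ assms(3), of "\<lambda>_. 1::nat"] by simp
  ultimately show False using assms(2) by simp
qed

text \<open>Two complete r-uniform hypergraphs on N = l q vertices are glued along N - 1 common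
  ones, leaving N and N + 1 over. In every colouring each copy uses each colour exactly q times, so
  both leftover vertices must take the one colour that occurs only q - 1 times in the common
  part.\<close>

lemma ex_xi_structure:
  assumes R: "R \<in> syms V" "2 \<le> arity V R" and l: "2 \<le> l" and k: "k = Strong \<Longrightarrow> arity V R \<le> l"
  shows "\<exists>S. xi_structure k V l S"
proof -
  define r where "r = arity V R"
  \<comment> \<open>The largest harmless colour class: r - 1 vertices contain no r-element edge,
    whereas in the strong case any two vertices of a clique share an edge.\<close>
  define q where "q = (if k = Plain then r - 1 else 1)"
  define N where "N = l * q"
  define Y2 where "Y2 = {1..N + 1} - {N}"
  define S :: "('a, nat) struct" where "S = \<lparr>universe = {1..N + 1},
    interp = (\<lambda>Q. if Q = R then {ts. length ts = r \<and> distinct ts \<and> (set ts \<subseteq> {1..N} \<or> set ts \<subseteq> Y2)} else {})\<rparr>"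
  have q: "1 \<le> q" unfolding q_def r_def using R(2) by (cases k) auto
  have N: "2 \<le> N" unfolding N_def using mult_le_mono[OF l q] by simp
  have "card Y2 = N"
    using N by (simp add: Y2_def card_Diff_singleton)
  then have cards: "card {1..N} = l * q" "card Y2 = l * q"
    by (simp_all add: N_def)
  have cond: "k = Plain \<and> r = Suc q \<or> k = Strong \<and> q = 1 \<and> 2 \<le> r \<and> r \<le> l * q"
    using R k by (cases k) (auto simp: q_def r_def)
  have clique: "(\<forall>ts. length ts = r \<and> distinct ts \<and> set ts \<subseteq> Y \<longrightarrow> admissible k (map \<gamma> ts)) \<longleftrightarrow>
      (\<forall>i. card {y \<in> Y. \<gamma> y = i} \<le> q)" if "Y = {1..N} \<or> Y = Y2" for Y \<gamma>
    by (rule clique_colouring_iff) (use that cond cards in \<open>auto simp: Y2_def\<close>)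
  have col: "colouring k V l \<gamma> S \<longleftrightarrow> \<gamma> \<in> {1..N + 1} \<rightarrow>\<^sub>E {1..l} \<and>
      (\<forall>i. card {y \<in> {1..N}. \<gamma> y = i} \<le> q) \<and> (\<forall>i. card {y \<in> Y2. \<gamma> y = i} \<le> q)" for \<gamma>
  proof -
    have "colouring k V l \<gamma> S \<longleftrightarrow> \<gamma> \<in> {1..N + 1} \<rightarrow>\<^sub>E {1..l} \<and>
      (\<forall>ts. length ts = r \<and> distinct ts \<and> set ts \<subseteq> {1..N} \<longrightarrow> admissible k (map \<gamma> ts)) \<and>
      (\<forall>ts. length ts = r \<and> distinct ts \<and> set ts \<subseteq> Y2 \<longrightarrow> admissible k (map \<gamma> ts))"
      using R unfolding colouring_def S_def by (auto split: if_splits)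
    then show ?thesis using clique[of "{1..N}" \<gamma>] clique[of Y2 \<gamma>] by simp
  qed
  have str: "is_struct V S"
    using R unfolding is_struct_def S_def by (auto simp: tuples_def r_def Y2_def)
  have same: "\<gamma> N = \<gamma> (N + 1)" if \<gamma>: "colouring k V l \<gamma> S" for \<gamma>
  proof (rule ccontr)
    assume ne: "\<gamma> N \<noteq> \<gamma> (N + 1)"
    have range: "\<gamma> y \<in> {1..l}" if "y \<in> {1..N + 1}" for y
      using \<gamma> col that by blast
    have rN: "\<gamma> N \<in> {1..l}" using range N by simp
    have "card {y \<in> {1..N}. \<gamma> y = \<gamma> N} = q"
    proof (rule card_colour_class_eq[OF _ cards(1) _ _ rN])
      show "\<gamma> ` {1..N} \<subseteq> {1..l}" by (intro image_subsetI range) simp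
      show "finite {1..N}" by simp
    qed (use \<gamma> col in blast)+
    moreover have "card {y \<in> Y2. \<gamma> y = \<gamma> N} = q"
    proof (rule card_colour_class_eq[OF _ cards(2) _ _ rN])
      show "\<gamma> ` Y2 \<subseteq> {1..l}" by (intro image_subsetI range) (simp add: Y2_def)
      show "finite Y2" by (simp add: Y2_def)
    qed (use \<gamma> col in blast)+
    \<comment> \<open>If the colours of N and N + 1 differed, the class of N would lose a point in
      passing from the first copy to the second, although it has q points in both.\<close>
    moreover have "{y \<in> {1..N}. \<gamma> y = \<gamma> N} = insert N {y \<in> Y2. \<gamma> y = \<gamma> N}"
      using N ne by (auto simp: Y2_def le_Suc_eq)
    moreover have "N \<notin> {y \<in> Y2. \<gamma> y = \<gamma> N}" "finite Y2" by (auto simp: Y2_def)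
    ultimately show False by simp
  qed
  have ex: "\<exists>\<gamma>. colouring k V l \<gamma> S \<and> \<gamma> N = i \<and> \<gamma> (N + 1) = i" if i: "i \<in> {1..l}" for i
  proof -
    \<comment> \<open>Consecutive runs of q vertices share a colour, so N lies in the last run, of
      colour l, and N + 1 repeats that colour. The transposition in \<open>c\<close> then exchanges
      l with the prescribed i.\<close>
    define c0 where "c0 a = (if a \<le> N then (a - 1) div q + 1 else l)" for a
    define c where "c = restrict (\<lambda>a. transpose l i (c0 a)) {1..N + 1}"
    have "l = Suc (l - 1)" using l by simp
    then have "N = q * (l - 1) + q" unfolding N_def by (metis mult.commute mult_Suc_right add.commute)
    then have "q * (l - 1) \<le> N - 1" "N - 1 < q * Suc (l - 1)"
      using q unfolding mult_Suc_right by linarith+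
    then have "(N - 1) div q = l - 1"
      by (rule div_nat_eqI)
    then have c0N: "c0 N = l" "c0 (N + 1) = l" using l by (simp_all add: c0_def)
    have "c0 a \<in> {1..l}" if "a \<in> {1..N + 1}" for a
    proof (cases "a \<le> N")
      case True
      then have "a - 1 < l * q" using N that unfolding N_def by auto
      then have "(a - 1) div q < l" by (rule less_mult_imp_div_less)
      then show ?thesis using True by (simp add: c0_def)
    qed (use l in \<open>simp add: c0_def\<close>)
    then have ran: "c \<in> {1..N + 1} \<rightarrow>\<^sub>E {1..l}"
      using i l by (auto simp: c_def transpose_def)
    have class1: "card {y \<in> {1..N}. c y = j} \<le> q" for j
    proof -
      define j' where "j' = transpose l i j - 1"
      have "{y \<in> {1..N}. c y = j} \<subseteq> {j' * q + 1..j' * q + q}"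
      proof clarify
        fix y assume y: "y \<in> {1..N}" "j = c y"
        then have "transpose l i j = (y - 1) div q + 1"
          by (simp add: c_def c0_def)
        then have "j' = (y - 1) div q" by (simp add: j'_def)
        then have "j' * q + (y - 1) mod q = y - 1" "(y - 1) mod q < q"
          using q by simp_all
        then show "y \<in> {j' * q + 1..j' * q + q}"
          using y(1) unfolding atLeastAtMost_iff by (intro conjI) linarith+
      qed
      then have "card {y \<in> {1..N}. c y = j} \<le> card {j' * q + 1..j' * q + q}"
        by (intro card_mono) auto
      then show ?thesis by simp
    qed
    have class2: "card {y \<in> Y2. c y = j} \<le> q" for j
    proof -
      \<comment> \<open>The injection replaces N + 1 by N, which has the same colour under
        \<open>c\<close> and is absent from \<open>Y2\<close>.\<close>
      have "card {y \<in> Y2. c y = j} \<le> card {y \<in> {1..N}. c y = j}"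
        by (rule card_inj_on_le[of "\<lambda>a. if a = N + 1 then N else a"])
          (use N c0N in \<open>auto simp: inj_on_def Y2_def c_def\<close>)
      then show ?thesis using class1[of j] by simp
    qed
    have "c N = i" "c (N + 1) = i" using c0N N by (simp_all add: c_def)
    then show ?thesis using col ran class1 class2 by blast
  qed
  have "xi_structure k V l S"
    unfolding xi_structure_def
  proof (intro conjI exI[of _ "N + 1"] allI impI ballI)
    show "colourable k V l S" using ex[of 1] l unfolding colourable_def by auto
    show "universe S = {1..N + 1}" by (simp add: S_def)
  qed (use str same ex N in auto)
  then show ?thesis by blast
qed

section \<open>The number of colourings of a generic structure\<close>

lemma generic_mono: "generic k V l m' \<gamma> M \<Longrightarrow> m \<le> m' \<Longrightarrow> generic k V l m \<gamma> M"
  unfolding generic_def by (meson le_trans)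

text \<open>Every colouring is constant on the colour classes of \<open>\<gamma>0\<close>, so it is
  determined by its values at one representative per class. The bound counts all maps from
  \<open>{1..l}\<close> to itself rather than only permutations.\<close>

lemma card_colourings_generic:
  assumes S: "xi_structure k V l S" "universe S = {1..s}" "s \<le> m"
    and M: "generic k V l m \<gamma>0 M" "(\<gamma>0, M) \<in> coloured k V l n"
    and ar: "\<forall>R\<in>syms V. 2 \<le> arity V R"
  shows "card {\<gamma>. (\<gamma>, M) \<in> coloured k V l n} \<le> l ^ l"
proof -
  note M' = colouredD[OF M(2)]
  have det: "\<gamma> a = \<gamma> b"
    if \<gamma>: "(\<gamma>, M) \<in> coloured k V l n" and ab: "a \<in> universe M" "b \<in> universe M" "\<gamma>0 a = \<gamma>0 b"
    for \<gamma> a b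
  proof (cases "a = b")
    case False
    then obtain h where h: "embedding V h S M" "h (s - 1) = a" "h s = b"
      using generic_same_colour[OF S M ar ab] by blast
    then show ?thesis
      using same_colour_if_embedding[OF S(1,2) h(1) colouredD(3)[OF \<gamma>]] by simp
  qed simp
  \<comment> \<open>Genericity over the empty base set with the empty pattern: every colour is
    used.\<close>
  have "\<exists>a. a \<in> universe M \<and> \<gamma>0 a = i" if i: "i \<in> {1..l}" for i
    by (rule genericE[OF M(1) empty_subsetI _ i empty_subsetI]) auto
  then obtain rep where rep: "\<And>i. i \<in> {1..l} \<Longrightarrow> rep i \<in> universe M \<and> \<gamma>0 (rep i) = i"
    by metis
  let ?F = "\<lambda>\<gamma>. restrict (\<lambda>i. \<gamma> (rep i)) {1..l}"
  have "card {\<gamma>. (\<gamma>, M) \<in> coloured k V l n} \<le> card ({1..l} \<rightarrow>\<^sub>E {1..l})"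
  proof (rule card_inj_on_le[of ?F])
    show "inj_on ?F {\<gamma>. (\<gamma>, M) \<in> coloured k V l n}"
    proof (rule inj_onI, clarify)
      fix \<gamma> \<gamma>' assume *: "(\<gamma>, M) \<in> coloured k V l n" "(\<gamma>', M) \<in> coloured k V l n"
        and eq: "?F \<gamma> = ?F \<gamma>'"
      have "\<gamma> a = \<gamma>' a" if a: "a \<in> universe M" for a
      proof -
        have i: "\<gamma>0 a \<in> {1..l}" using colouring_range[OF M'(3) a] .
        have "\<gamma> a = \<gamma> (rep (\<gamma>0 a))" "\<gamma>' a = \<gamma>' (rep (\<gamma>0 a))"
          using det[OF *(1)] det[OF *(2)] rep[OF i] a by metis+
        then show ?thesis using fun_cong[OF eq, of "\<gamma>0 a"] i by simp
      qed
      then show "\<gamma> = \<gamma>'" using colouredD(3)[OF *(1)] colouredD(3)[OF *(2)] by (intro colouring_eqI)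
    qed
    show "?F ` {\<gamma>. (\<gamma>, M) \<in> coloured k V l n} \<subseteq> {1..l} \<rightarrow>\<^sub>E {1..l}"
    proof (intro image_subsetI restrict_PiE_iff[THEN iffD2] ballI)
      fix \<gamma> i assume "\<gamma> \<in> {\<gamma>. (\<gamma>, M) \<in> coloured k V l n}" "i \<in> {1..l}"
      then show "\<gamma> (rep i) \<in> {1..l}"
        using rep colouring_range[OF colouredD(3)] by blast
    qed
  qed (simp add: finite_PiE)
  then show ?thesis by (simp add: card_PiE)
qed

section \<open>Almost all structures are generic\<close>

lemma proportion_nonneg: "0 \<le> proportion X P"
  by (simp add: proportion_def)

lemma proportion_le_1: "finite X \<Longrightarrow> proportion X P \<le> 1"
  using card_mono[of X "{x \<in> X. P x}"] by (auto simp: proportion_def divide_le_eq_1 card_gt_0_iff)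

lemma proportion_le_add:
  assumes "real (card {x \<in> X. P x}) \<le> real (card {x \<in> X. Q x}) + \<epsilon> * real (card X)" "0 \<le> \<epsilon>"
  shows "proportion X P \<le> proportion X Q + \<epsilon>"
proof (cases "card X = 0")
  case False
  then have "proportion X P \<le> (real (card {x \<in> X. Q x}) + \<epsilon> * real (card X)) / real (card X)"
    unfolding proportion_def using assms(1) by (intro divide_right_mono) auto
  also have "\<dots> = proportion X Q + \<epsilon>"
    using False by (simp add: proportion_def add_divide_distrib)
  finally show ?thesis .
qed (simp add: proportion_def assms(2))

lemma proportion_mono:
  assumes "finite X" "\<And>x. x \<in> X \<Longrightarrow> P x \<Longrightarrow> Q x"
  shows "proportion X P \<le> proportion X Q"
  unfolding proportion_def using assms
  by (intro divide_right_mono of_nat_mono card_mono) auto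

text \<open>Only an inequality, because for an empty X both proportions are 0 by the convention on
  division by zero.\<close>

lemma proportion_not:
  assumes "finite X"
  shows "proportion X (\<lambda>x. \<not> P x) \<le> 1 - proportion X P"
proof (cases "X = {}")
  case False
  have "card X = card {x \<in> X. P x} + card {x \<in> X. \<not> P x}"
    using assms by (subst card_Un_disjoint[symmetric]) (auto intro: arg_cong[of _ _ card])
  then have "real (card {x \<in> X. P x}) + real (card {x \<in> X. \<not> P x}) = real (card X)"
    by simp
  then have "proportion X P + proportion X (\<lambda>x. \<not> P x) = real (card X) / real (card X)"
    by (simp only: proportion_def flip: add_divide_distrib)
  then show ?thesis
    using assms False by simp
qed (simp add: proportion_def)

lemma proportion_tendsto_1:
  assumes fin: "\<And>n. finite (X n)" and P: "(\<lambda>n. proportion (X n) (P n)) \<longlonglongrightarrow> 1"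
    and \<epsilon>: "\<epsilon> \<longlonglongrightarrow> 0"
    and le: "eventually (\<lambda>n. proportion (X n) (P n) \<le> proportion (X n) (Q n) + \<epsilon> n) sequentially"
  shows "(\<lambda>n. proportion (X n) (Q n)) \<longlonglongrightarrow> 1"
proof (rule tendsto_sandwich)
  show "(\<lambda>n. proportion (X n) (P n) - \<epsilon> n) \<longlonglongrightarrow> 1"
    using tendsto_diff[OF P \<epsilon>] by simp
  show "\<forall>\<^sub>F n in sequentially. proportion (X n) (P n) - \<epsilon> n \<le> proportion (X n) (Q n)"
    using le by eventually_elim simp
  show "\<forall>\<^sub>F n in sequentially. proportion (X n) (Q n) \<le> 1"
    using proportion_le_1[OF fin] by simp
qed simp

lemma proportion_tendsto_1_mono:
  assumes "\<And>n. finite (X n)" "(\<lambda>n. proportion (X n) (P n)) \<longlonglongrightarrow> 1"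
    and "\<And>n x. x \<in> X n \<Longrightarrow> P n x \<Longrightarrow> Q n x"
  shows "(\<lambda>n. proportion (X n) (Q n)) \<longlonglongrightarrow> 1"
  by (rule proportion_tendsto_1[OF assms(1,2), of "\<lambda>_. 0"])
    (simp_all add: proportion_mono[OF assms(1) assms(3)])

text \<open>The good elements of all the sets agree on P, across different n as well. One good
  element with P thus forces P on all good ones; otherwise P fails on all of them.\<close>

lemma proportion_dichotomy:
  assumes fin: "\<And>n. finite (X n)" and G: "(\<lambda>n. proportion (X n) (G n)) \<longlonglongrightarrow> 1"
    and agree: "\<And>n n' x x'. x \<in> X n \<Longrightarrow> G n x \<Longrightarrow> x' \<in> X n' \<Longrightarrow> G n' x' \<Longrightarrow> P x \<longleftrightarrow> P x'"
  shows "(\<lambda>n. proportion (X n) P) \<longlonglongrightarrow> 0 \<or> (\<lambda>n. proportion (X n) P) \<longlonglongrightarrow> 1"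
proof (cases "\<exists>n. \<exists>x\<in>X n. G n x \<and> P x")
  case True
  then have "(\<lambda>n. proportion (X n) P) \<longlonglongrightarrow> 1"
    using agree by (intro proportion_tendsto_1_mono[OF fin G]) blast
  then show ?thesis ..
next
  case False
  then have "(\<lambda>n. proportion (X n) (\<lambda>x. \<not> P x)) \<longlonglongrightarrow> 1"
    by (intro proportion_tendsto_1_mono[OF fin G]) blast
  then have "(\<lambda>n. 1 - proportion (X n) (\<lambda>x. \<not> P x)) \<longlonglongrightarrow> 1 - 1"
    by (intro tendsto_intros)
  then have lim: "(\<lambda>n. 1 - proportion (X n) (\<lambda>x. \<not> P x)) \<longlonglongrightarrow> 0"
    by simp
  have "proportion (X n) P \<le> 1 - proportion (X n) (\<lambda>x. \<not> P x)" for n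
    using proportion_not[OF fin, of n "\<lambda>x. \<not> P x"] by simp
  then have "(\<lambda>n. proportion (X n) P) \<longlonglongrightarrow> 0"
    by (intro tendsto_sandwich[OF _ _ tendsto_const lim] always_eventually allI proportion_nonneg)
  then show ?thesis ..
qed

lemma almost_all_coloured_generic:
  assumes V: "finite (syms V)" "syms V \<noteq> {}"
    and f: "filterlim (\<lambda>n. f n / ln (real n)) at_top sequentially"
    and rich: "(\<lambda>n. proportion (coloured k V l n) (\<lambda>(\<gamma>, M). rich l (f n) \<gamma> M)) \<longlonglongrightarrow> 1"
  shows "(\<lambda>n. proportion (coloured k V l n) (\<lambda>(\<gamma>, M). generic k V l m \<gamma> M)) \<longlonglongrightarrow> 1"
proof (rule proportion_tendsto_1[OF finite_coloured[OF V(1)] rich failure_bound_tendsto[OF V f]])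
  show "\<forall>\<^sub>F n in sequentially. proportion (coloured k V l n) (\<lambda>(\<gamma>, M). rich l (f n) \<gamma> M) \<le>
      proportion (coloured k V l n) (\<lambda>(\<gamma>, M). generic k V l m \<gamma> M) + failure_bound V l m n (f n)"
  proof (intro always_eventually allI proportion_le_add)
    fix n
    let ?C = "coloured k V l n" and ?\<epsilon> = "failure_bound V l m n (f n)"
    let ?R = "{(\<gamma>, M) \<in> ?C. rich l (f n) \<gamma> M}" and ?G = "{(\<gamma>, M) \<in> ?C. generic k V l m \<gamma> M}"
      and ?B = "{(\<gamma>, M) \<in> ?C. rich l (f n) \<gamma> M \<and> \<not> generic k V l m \<gamma> M}"
    have fin: "finite {(\<gamma>, M) \<in> ?C. Q \<gamma> M}" for Q
      by (rule finite_subset[OF _ finite_coloured[OF V(1)]]) auto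
    show nonneg: "0 \<le> ?\<epsilon>" by (simp add: failure_bound_def)
    have "card ?R \<le> card (?G \<union> ?B)"
      by (rule card_mono) (use fin in auto)
    also have "\<dots> \<le> card ?G + card ?B" by (rule card_Un_le)
    finally have "real (card ?R) \<le> real (card ?G) + real (card ?B)" by simp
    also have "real (card ?B) \<le> ?\<epsilon> * real (card ?R)"
      by (rule card_rich_nongeneric[OF V])
    also have "\<dots> \<le> ?\<epsilon> * real (card ?C)"
      using nonneg by (intro mult_left_mono of_nat_mono card_mono finite_coloured[OF V(1)]) auto
    finally show "real (card {x \<in> ?C. case x of (\<gamma>, M) \<Rightarrow> rich l (f n) \<gamma> M}) \<le>
        real (card {x \<in> ?C. case x of (\<gamma>, M) \<Rightarrow> generic k V l m \<gamma> M}) + ?\<epsilon> * real (card ?C)"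
      by (simp add: case_prod_unfold)
  qed
qed

definition has_generic_colouring ::
  "kind \<Rightarrow> 'r vocab \<Rightarrow> nat \<Rightarrow> nat \<Rightarrow> nat \<Rightarrow> ('r, nat) struct \<Rightarrow> bool" where
  "has_generic_colouring k V l m n M \<longleftrightarrow> (\<exists>\<gamma>. (\<gamma>, M) \<in> coloured k V l n \<and> generic k V l m \<gamma> M)"

text \<open>A structure with a generic colouring has at most \<open>l ^ l\<close> colourings, so that passing from
  coloured structures to their reducts distorts proportions by a bounded factor only.\<close>

lemma almost_all_colourable_generic:
  assumes V: "finite (syms V)" "syms V \<noteq> {}" and ar: "\<forall>R\<in>syms V. 2 \<le> arity V R"
    and S: "xi_structure k V l S"
    and f: "filterlim (\<lambda>n. f n / ln (real n)) at_top sequentially"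
    and rich: "(\<lambda>n. proportion (CC k V l n) (has_rich_colouring k V l (f n))) \<longlonglongrightarrow> 1"
  shows "(\<lambda>n. proportion (CC k V l n) (has_generic_colouring k V l m n)) \<longlonglongrightarrow> 1"
proof -
  obtain s where s: "universe S = {1..s}" using S unfolding xi_structure_def by blast
  \<comment> \<open>The bound on the number of colourings requires genericity for at least s points,
    the size of S.\<close>
  define m' where "m' = max m s"
  have m': "m \<le> m'" "s \<le> m'" by (simp_all add: m'_def)
  have finCC: "finite (CC k V l n)" for n
    unfolding CC_eq using finite_coloured[OF V(1)] by simp
  define \<epsilon> where "\<epsilon> n = failure_bound V l m' n (f n)" for n
  have \<epsilon>: "\<epsilon> \<longlonglongrightarrow> 0" "\<And>n. 0 \<le> \<epsilon> n"
    unfolding \<epsilon>_def using failure_bound_tendsto[OF V f] by (simp_all add: failure_bound_def)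
  have "(\<lambda>n. 2 * \<epsilon> n * real (l ^ l)) \<longlonglongrightarrow> 2 * 0 * real (l ^ l)"
    by (intro tendsto_intros \<epsilon>)
  then have lim: "(\<lambda>n. 2 * \<epsilon> n * real (l ^ l)) \<longlonglongrightarrow> 0" by simp
  \<comment> \<open>The bad pairs are bounded by \<epsilon> times all rich pairs, themselves
    included; with \<epsilon> below 1/2 they can be absorbed, leaving 2 \<epsilon> times the good
    pairs.\<close>
  have "eventually (\<lambda>n. \<epsilon> n < 1 / 2) sequentially"
    using order_tendstoD(2)[OF \<epsilon>(1), of "1 / 2"] by simp
  then have "\<forall>\<^sub>F n in sequentially. proportion (CC k V l n) (has_rich_colouring k V l (f n)) \<le>
      proportion (CC k V l n) (has_generic_colouring k V l m' n) + 2 * \<epsilon> n * real (l ^ l)"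
  proof eventually_elim
    case (elim n)
    let ?C = "coloured k V l n"
    define R where "R = {(\<gamma>, M) \<in> ?C. rich l (f n) \<gamma> M}"
    define B where "B = {(\<gamma>, M) \<in> ?C. rich l (f n) \<gamma> M \<and> \<not> generic k V l m' \<gamma> M}"
    define H where "H = {M \<in> CC k V l n. has_generic_colouring k V l m' n M}"
    have fin: "finite R" "finite B" "finite H"
      using finite_coloured[OF V(1)] finCC unfolding R_def B_def H_def
      by (auto intro: finite_subset[of _ ?C])
    \<comment> \<open>Good rich pairs lie over structures in \<open>H\<close>, and each of these has
      at most \<open>l ^ l\<close> colourings.\<close>
    have "R - B \<subseteq> (\<lambda>(M, \<gamma>). (\<gamma>, M)) ` (SIGMA M:H. {\<gamma>. (\<gamma>, M) \<in> ?C})"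
    proof clarify
      fix \<gamma> M assume "(\<gamma>, M) \<in> R" "(\<gamma>, M) \<notin> B"
      then have *: "(\<gamma>, M) \<in> ?C" "generic k V l m' \<gamma> M" by (auto simp: R_def B_def)
      then have "M \<in> H"
        unfolding H_def has_generic_colouring_def CC_eq by force
      then show "(\<gamma>, M) \<in> (\<lambda>(M, \<gamma>). (\<gamma>, M)) ` (SIGMA M:H. {\<gamma>. (\<gamma>, M) \<in> ?C})"
        using *(1) by (intro image_eqI[of _ _ "(M, \<gamma>)"]) auto
    qed
    moreover have finF: "finite {\<gamma>. (\<gamma>, M) \<in> ?C}" for M
      by (rule finite_subset[of _ "fst ` ?C"]) (force intro: finite_coloured[OF V(1)])+
    ultimately have "card (R - B) \<le> card (SIGMA M:H. {\<gamma>. (\<gamma>, M) \<in> ?C})"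
      using fin by (intro surj_card_le) auto
    also have "\<dots> = (\<Sum>M\<in>H. card {\<gamma>. (\<gamma>, M) \<in> ?C})"
      using fin finF by (intro card_SigmaI) auto
    also have "\<dots> \<le> (\<Sum>M\<in>H. l ^ l)"
      using card_colourings_generic[OF S s m'(2) _ _ ar]
      by (intro sum_mono) (auto simp: H_def has_generic_colouring_def)
    finally have "card (R - B) \<le> card H * l ^ l" by simp
    then have 1: "real (card (R - B)) \<le> real (card H) * real (l ^ l)"
      by (metis of_nat_mono of_nat_mult)
    have sub: "B \<subseteq> R" by (auto simp: B_def R_def)
    have "card R = card (R - B) + card B"
      using fin sub card_mono[OF fin(1) sub] by (simp add: card_Diff_subset)
    then have 2: "real (card B) \<le> \<epsilon> n * (real (card (R - B)) + real (card B))"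
      using card_rich_nongeneric[OF V, of k l n "f n" m'] by (simp add: R_def B_def \<epsilon>_def)
    have "\<epsilon> n * real (card B) \<le> 1 / 2 * real (card B)"
      using elim by (intro mult_right_mono) auto
    then have "real (card B) \<le> 2 * \<epsilon> n * real (card (R - B))"
      using 2 by (simp add: algebra_simps)
    also have "\<dots> \<le> 2 * \<epsilon> n * (real (card H) * real (l ^ l))"
      using 1 \<epsilon>(2) by (intro mult_left_mono) auto
    also have "\<dots> \<le> 2 * \<epsilon> n * (real (card (CC k V l n)) * real (l ^ l))"
      using \<epsilon>(2) finCC unfolding H_def
      by (intro mult_left_mono mult_right_mono of_nat_mono card_mono) auto
    finally have 3: "real (card B) \<le> 2 * \<epsilon> n * real (l ^ l) * real (card (CC k V l n))"
      by (simp add: mult_ac)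
    \<comment> \<open>Any rich colouring of M either is generic or makes M the second component of a
      bad pair, so one pair per structure suffices here.\<close>
    have "{M \<in> CC k V l n. has_rich_colouring k V l (f n) M} \<subseteq> H \<union> snd ` B"
    proof clarify
      fix M assume M: "M \<in> CC k V l n" "has_rich_colouring k V l (f n) M" "M \<notin> snd ` B"
      then obtain \<gamma> where \<gamma>: "colouring k V l \<gamma> M" "rich l (f n) \<gamma> M"
        unfolding has_rich_colouring_def by blast
      have C: "(\<gamma>, M) \<in> ?C" using CC_D[OF M(1)] \<gamma>(1) by (simp add: coloured_def)
      have "(\<gamma>, M) \<notin> B" using M(3) by force
      then have "generic k V l m' \<gamma> M" using C \<gamma>(2) by (simp add: B_def)
      then show "M \<in> H" using M(1) C by (auto simp: H_def has_generic_colouring_def)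
    qed
    then have "card {M \<in> CC k V l n. has_rich_colouring k V l (f n) M} \<le> card (H \<union> snd ` B)"
      using fin by (intro card_mono) auto
    also have "\<dots> \<le> card H + card B"
      using card_Un_le[of H "snd ` B"] card_image_le[OF fin(2), of snd] by linarith
    finally have "real (card {M \<in> CC k V l n. has_rich_colouring k V l (f n) M}) \<le> real (card H) + real (card B)"
      by simp
    with 3 show ?case
      using \<epsilon>(2) unfolding H_def by (intro proportion_le_add) auto
  qed
  then have "(\<lambda>n. proportion (CC k V l n) (has_generic_colouring k V l m' n)) \<longlonglongrightarrow> 1"
    by (rule proportion_tendsto_1[OF finCC rich lim])
  then show ?thesis
    by (rule proportion_tendsto_1_mono[OF finCC])
      (auto simp: has_generic_colouring_def intro: generic_mono[OF _ m'(1)])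
qed

section \<open>Extension axioms in generic structures\<close>

lemma embedding_cong:
  assumes "embedding V g D M" "\<And>x. x \<in> universe D \<Longrightarrow> h x = g x"
  shows "embedding V h D M"
proof -
  have "map h ts = map g ts" if "ts \<in> tuples (universe D) j" for ts j
    using that assms(2) by (auto simp: tuples_def)
  then have "\<forall>R\<in>syms V. \<forall>ts\<in>tuples (universe D) (arity V R). ts \<in> interp D R \<longleftrightarrow> map h ts \<in> interp M R"
    using assms(1) unfolding embedding_def by metis
  moreover have "inj_on h (universe D) \<longleftrightarrow> inj_on g (universe D)" "h ` universe D = g ` universe D"
    using assms(2) by (auto simp: inj_on_def)
  ultimately show ?thesis
    using assms(1) unfolding embedding_def by simp
qed

text \<open>Admissibility only compares colours for equality. This handles the renaming of colours
  that the permutations in the compatible axioms introduce.\<close>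

lemma admissible_map_inj:
  assumes "inj_on f (set cs)"
  shows "admissible k (map f cs) \<longleftrightarrow> admissible k cs"
proof -
  have "map f cs ! i = map f cs ! j \<longleftrightarrow> cs ! i = cs ! j" if "i < length cs" "j < length cs" for i j
    using assms that by (auto dest: inj_onD)
  then show ?thesis by (cases k) (simp only: admissible.simps length_map, metis)+
qed

text \<open>An embedding for the full language preserves the colour predicates, so on A it is a
  \<open>colour_embedding\<close>, and it extends point by point to B.\<close>

lemma generic_satisfies_extension_axiom:
  assumes AB: "extension_pair k V l A B"
    and M: "generic k V l (card (universe B)) \<gamma> M" "(\<gamma>, M) \<in> coloured k V l n"
  shows "satisfies_extension_axiom (colour_vocab V l) A B (expand \<gamma> M)"
  unfolding satisfies_extension_axiom_def
proof (intro allI impI)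
  fix g assume g: "embedding (colour_vocab V l) g A (expand \<gamma> M)"
  have A: "universe A \<subseteq> universe B" "\<And>R. interp A R = {ts \<in> interp B R. set ts \<subseteq> universe A}"
    and B: "is_struct (colour_vocab V l) B" "finite (universe B)"
    using AB unfolding extension_pair_def substructure_def by auto
  obtain n' N e where N: "N \<in> KK k V l n'" and e: "embedding (colour_vocab V l) e B N"
    using AB unfolding extension_pair_def by blast
  obtain \<delta> N' where N': "(\<delta>, N') \<in> coloured k V l n'" and "N = expand \<delta> N'"
    using KK_cases[OF N] by metis
  then have e: "embedding (colour_vocab V l) e B (expand \<delta> N')" using e by simp
  \<comment> \<open>B is known to be properly coloured only through its embedding e into a member of
    \<open>KK\<close>, so its colours are read off there.\<close>
  define c where "c = (\<lambda>b. \<delta> (e b))"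
  have eB: "e b \<in> universe N'" if "b \<in> universe B" for b
    using e that by (auto simp: embedding_def)
  have c_range: "c b \<in> {1..l}" if "b \<in> universe B" for b
    unfolding c_def using colouring_range[OF colouredD(3)[OF N'] eB[OF that]] .
  have colB: "[b] \<in> interp B (Inr i) \<longleftrightarrow> c b = i" if "b \<in> universe B" "i \<in> {1..l}" for b i
  proof -
    have "[b] \<in> tuples (universe B) (arity (colour_vocab V l) (Inr i))" "Inr i \<in> syms (colour_vocab V l)"
      using that by (auto simp: tuples_def)
    then have "[b] \<in> interp B (Inr i) \<longleftrightarrow> map e [b] \<in> interp (expand \<delta> N') (Inr i)"
      using e unfolding embedding_def by blast
    then show ?thesis using eB[OF that(1)] by (simp add: c_def)
  qed
  have admB: "admissible k (map c ts)" if "R \<in> syms V" "ts \<in> interp (reduct B) R" for R ts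
  proof -
    have ts: "ts \<in> interp B (Inl R)" "Inl R \<in> syms (colour_vocab V l)"
      using that by (auto simp: reduct_def)
    then have "map e ts \<in> interp (expand \<delta> N') (Inl R)"
      using e is_struct_tuples[OF B(1) ts(1)] unfolding embedding_def by blast
    then have "admissible k (map \<delta> (map e ts))"
      using colouredD(3)[OF N'] that(1) by (simp add: colouring_def del: map_map)
    then show ?thesis by (simp add: c_def comp_def)
  qed
  have "colour_embedding V c (reduct B) \<gamma> M (universe A) g"
    unfolding colour_embedding_def
  proof (intro conjI ballI)
    show "inj_on g (universe A)" "g ` universe A \<subseteq> universe M"
      using g by (auto simp: embedding_def)
    fix x assume x: "x \<in> universe A"
    then have cx: "c x \<in> {1..l}" using c_range A(1) by blast
    have "[x] \<in> interp A (Inr (c x))"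
      using colB[of x "c x"] x A cx by auto
    moreover have "[x] \<in> tuples (universe A) (arity (colour_vocab V l) (Inr (c x)))"
        "Inr (c x) \<in> syms (colour_vocab V l)"
      using x cx by (auto simp: tuples_def)
    ultimately have "map g [x] \<in> interp (expand \<gamma> M) (Inr (c x))"
      using g unfolding embedding_def by blast
    then show "\<gamma> (g x) = c x" by simp
  next
    fix R ts assume R: "R \<in> syms V" and ts: "ts \<in> tuples (universe A) (arity V R)"
    then have "Inl R \<in> syms (colour_vocab V l)" "ts \<in> tuples (universe A) (arity (colour_vocab V l) (Inl R))"
      by auto
    then have "ts \<in> interp A (Inl R) \<longleftrightarrow> map g ts \<in> interp (expand \<gamma> M) (Inl R)"
      using g unfolding embedding_def by blast
    then show "ts \<in> interp (reduct B) R \<longleftrightarrow> map g ts \<in> interp M R"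
      using A(2) ts by (auto simp: tuples_def reduct_def)
  qed
  moreover have "0 \<notin> universe M" using colouredD(2)[OF M(2)] by simp
  ultimately obtain h where h: "colour_embedding V c (reduct B) \<gamma> M (universe B) h"
      "\<forall>x\<in>universe A. h x = g x"
    using extend_colour_embedding[OF M(1) _ B(2) order_refl A(1), of c "reduct B" g] c_range admB by blast
  have "embedding (colour_vocab V l) h B (expand \<gamma> M)"
    unfolding embedding_def
  proof (intro conjI ballI)
    show "inj_on h (universe B)" "h ` universe B \<subseteq> universe (expand \<gamma> M)"
      using h(1) by (auto simp: colour_embedding_def)
    fix Q ts assume Q: "Q \<in> syms (colour_vocab V l)" and ts: "ts \<in> tuples (universe B) (arity (colour_vocab V l) Q)"
    show "ts \<in> interp B Q \<longleftrightarrow> map h ts \<in> interp (expand \<gamma> M) Q"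
    proof (cases Q)
      case (Inl R)
      then have R: "R \<in> syms V" "ts \<in> tuples (universe B) (arity V R)" using Q ts by auto
      have "ts \<in> interp (reduct B) R \<longleftrightarrow> map h ts \<in> interp M R"
        using h(1) R unfolding colour_embedding_def by blast
      then show ?thesis using Inl by (simp add: reduct_def)
    next
      case (Inr i)
      then obtain b where b: "ts = [b]" "b \<in> universe B" and i: "i \<in> {1..l}"
        using Q ts by (auto simp: tuples_def length_Suc_conv)
      have "\<gamma> (h b) = c b" "h b \<in> universe M"
        using h(1) b(2) by (auto simp: colour_embedding_def)
      then show ?thesis using colB[OF b(2) i] b(1) Inr by simp
    qed
  qed
  then show "\<exists>h. embedding (colour_vocab V l) h B (expand \<gamma> M) \<and> (\<forall>a\<in>universe A. h a = g a)"
    using h(2) by blast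
qed

section \<open>Truth of the compatible axioms in generic structures\<close>

lemma sat_Exs:
  "sat M e (Exs vs p) \<longleftrightarrow>
     (\<exists>e'. (\<forall>v\<in>set vs. e' v \<in> universe M) \<and> (\<forall>v. v \<notin> set vs \<longrightarrow> e' v = e v) \<and> sat M e' p)"
proof (induction vs arbitrary: e)
  case Nil
  have "(\<forall>v. e' v = e v) \<longleftrightarrow> e' = e" for e' by auto
  then show ?case by (simp add: Exs_def)
next
  case (Cons v vs)
  have "sat M e (Exs (v # vs) p) \<longleftrightarrow> (\<exists>a\<in>universe M. sat M (e(v := a)) (Exs vs p))"
    by (simp add: Exs_def)
  also have "\<dots> \<longleftrightarrow> (\<exists>e'. (\<forall>w\<in>set (v # vs). e' w \<in> universe M) \<and>
      (\<forall>w. w \<notin> set (v # vs) \<longrightarrow> e' w = e w) \<and> sat M e' p)" (is "?L \<longleftrightarrow> ?R")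
  proof
    assume ?L
    then obtain a e' where *: "a \<in> universe M" "\<forall>w\<in>set vs. e' w \<in> universe M"
      "\<forall>w. w \<notin> set vs \<longrightarrow> e' w = (e(v := a)) w" "sat M e' p"
      unfolding Cons.IH by blast
    \<comment> \<open>If v occurs again in \<open>vs\<close>, the inner quantifier overrides the
      value a.\<close>
    then have "e' v \<in> universe M" by (cases "v \<in> set vs") auto
    then show ?R using * by (intro exI[of _ e']) auto
  next
    assume ?R
    then obtain e' where *: "\<forall>w\<in>set (v # vs). e' w \<in> universe M"
      "\<forall>w. w \<notin> set (v # vs) \<longrightarrow> e' w = e w" "sat M e' p" by blast
    then show ?L
      unfolding Cons.IH by (intro bexI[of _ "e' v"] exI[of _ e']) auto
  qed
  finally show ?case .
qed

lemma sat_Alls: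
  "sat M e (Alls vs p) \<longleftrightarrow>
     (\<forall>e'. (\<forall>v\<in>set vs. e' v \<in> universe M) \<and> (\<forall>v. v \<notin> set vs \<longrightarrow> e' v = e v) \<longrightarrow> sat M e' p)"
proof -
  have "sat M e (Exs vs (Neg p)) \<longleftrightarrow> \<not> sat M e (Alls vs p)" for e
    by (induction vs arbitrary: e) (auto simp: Exs_def Alls_def)
  then show ?thesis using sat_Exs[of M e vs "Neg p"] by auto
qed

text \<open>The conditions on y and z keep them from being captured by the quantifiers over the
  \<open>VU\<close> variables.\<close>

lemma sat_xi:
  assumes V: "finite (syms V)" and S: "is_struct V S" "universe S = {1..s}" "3 \<le> s"
    and yz: "\<And>i. y \<noteq> VU i" "\<And>i. z \<noteq> VU i" "e y \<in> universe M" "e z \<in> universe M"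
  shows "sat M e (xi V S y z) \<longleftrightarrow>
    e y = e z \<or> (\<exists>h. embedding V h S M \<and> h (s - 1) = e y \<and> h s = e z)"
proof -
  define v where "v = (\<lambda>i. if i = s - 1 then y else if i = s then z else VU i)"
  let ?us = "map VU [1..<s - 1]"
  have xi: "xi V S y z = Or (Eq y z) (Exs ?us (chi V S v))"
    by (simp add: xi_def S(2) v_def Let_def)
  have finS: "finite (universe S)" by (simp add: S(2))
  have "sat M e (Exs ?us (chi V S v)) \<longleftrightarrow> (\<exists>h. embedding V h S M \<and> h (s - 1) = e y \<and> h s = e z)"
  proof
    assume "sat M e (Exs ?us (chi V S v))"
    then obtain e' where e': "\<And>w. w \<in> set ?us \<Longrightarrow> e' w \<in> universe M"
      "\<And>w. w \<notin> set ?us \<Longrightarrow> e' w = e w" "sat M e' (chi V S v)"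
      unfolding sat_Exs by blast
    have yz': "e' y = e y" "e' z = e z" using yz(1,2) by (simp_all add: image_iff e'(2))
    have "e' (v i) \<in> universe M" if "i \<in> universe S" for i
    proof (cases "i = s - 1 \<or> i = s")
      case True
      then show ?thesis using yz' yz(3,4) by (auto simp: v_def)
    next
      case False
      then have "v i \<in> set ?us" using that S(2) by (auto simp: v_def)
      then show ?thesis by (rule e'(1))
    qed
    then have "embedding V (\<lambda>i. e' (v i)) S M"
      using sat_chi[OF V S(1) finS] e'(3) by blast
    then show "\<exists>h. embedding V h S M \<and> h (s - 1) = e y \<and> h s = e z"
      using yz' S(3) by (intro exI[of _ "\<lambda>i. e' (v i)"]) (auto simp: v_def)
  next
    assume "\<exists>h. embedding V h S M \<and> h (s - 1) = e y \<and> h s = e z"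
    then obtain h where h: "embedding V h S M" "h (s - 1) = e y" "h s = e z" by blast
    define e' where "e' w = (case w of VU i \<Rightarrow> if i \<in> {1..<s - 1} then h i else e w | _ \<Rightarrow> e w)" for w
    have yz': "e' y = e y" "e' z = e z"
      using yz(1,2) by (auto simp: e'_def split: var.splits)
    have v: "e' (v i) = h i" if "i \<in> universe S" for i
      using that yz' h S(2) by (auto simp: v_def e'_def)
    have hS: "h i \<in> universe M" if "i \<in> universe S" for i
      using h(1) that by (auto simp: embedding_def)
    have "embedding V (\<lambda>i. e' (v i)) S M"
      using v by (rule embedding_cong[OF h(1)])
    then have "sat M e' (chi V S v)"
      using sat_chi[OF V S(1) finS, of e' v M] v hS by simp
    moreover have "e' w \<in> universe M" if "w \<in> set ?us" for w
      using that hS S(2) by (auto simp: e'_def)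
    moreover have "e' w = e w" if "w \<notin> set ?us" for w
      using that by (auto simp: e'_def split: var.splits)
    ultimately show "sat M e (Exs ?us (chi V S v))"
      unfolding sat_Exs by blast
  qed
  then show ?thesis unfolding xi by auto
qed

text \<open>Distinct points of one colour are joined by a copy of S through genericity; conversely,
  such a copy forces equal colours in any colouring. So equality of colours is definable without the
  colour predicates.\<close>

lemma sat_xi_generic:
  assumes V: "finite (syms V)" "\<forall>R\<in>syms V. 2 \<le> arity V R"
    and S: "xi_structure k V l S" "universe S = {1..s}" "s \<le> m"
    and M: "generic k V l m \<gamma> M" "(\<gamma>, M) \<in> coloured k V l n"
    and yz: "\<And>i. y \<noteq> VU i" "\<And>i. z \<noteq> VU i" "e y \<in> universe M" "e z \<in> universe M"
  shows "sat M e (xi V S y z) \<longleftrightarrow> \<gamma> (e y) = \<gamma> (e z)"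
proof -
  obtain t where t: "3 \<le> t" "universe S = {1..t}" "is_struct V S"
    using S(1) unfolding xi_structure_def by blast
  have "card (universe S) = t" "card (universe S) = s"
    by (simp add: t(2), simp add: S(2))
  then have "sat M e (xi V S y z) \<longleftrightarrow>
      e y = e z \<or> (\<exists>h. embedding V h S M \<and> h (s - 1) = e y \<and> h s = e z)"
    using t by (intro sat_xi[OF V(1) t(3) S(2) _ yz]) simp
  also have "\<dots> \<longleftrightarrow> \<gamma> (e y) = \<gamma> (e z)"
    using generic_same_colour[OF S M V(2) yz(3,4)]
      same_colour_if_embedding[OF S(1,2) _ colouredD(3)[OF M(2)]] by metis
  finally show ?thesis .
qed

text \<open>The formula \<zeta> forces the first l of the x's to have distinct colours, so they name
  the colours of M up to a permutation. Read through these names, \<open>\<gamma>'\<close> becomes a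
  colouring of B that matches \<gamma> on the given copy of A, and genericity extends this
  copy.\<close>

lemma generic_models_compatible_axiom:
  assumes V: "finite (syms V)" "\<forall>R\<in>syms V. 2 \<le> arity V R"
    and S: "xi_structure k V l S" "universe S = {1..s}" "s \<le> m"
    and U: "zeta_structure k V l U \<delta>"
    and AB: "compatible_pair k V l A B" "card (universe B) \<le> m"
    and M: "generic k V l m \<gamma> M" "(\<gamma>, M) \<in> coloured k V l n" and l: "1 \<le> l"
  shows "models M (compatible_axiom k V l S U \<delta> A B)"
proof -
  obtain \<alpha> \<beta> where \<alpha>\<beta>: "universe A = {1..\<alpha>}" "universe B = {1..\<beta>}" "\<alpha> < \<beta>"
    and A: "is_struct V A" "is_struct V B"
    and sub: "\<And>R. interp A R = {ts \<in> interp B R. set ts \<subseteq> universe A}"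
    using AB(1) unfolding compatible_pair_def substructure_def by blast
  obtain u where u: "universe U = {1..u}"
    using U unfolding zeta_structure_def by blast
  have lu: "{1..l} \<subseteq> {1..u}" and inj: "inj_on \<delta> {1..l}"
    using U unfolding zeta_structure_def u by blast+
  have M0: "0 \<notin> universe M" using colouredD(2)[OF M(2)] by simp
  have "sat M e (compatible_instance V S U \<delta> A B \<gamma>' \<tau>)"
    if \<gamma>': "colouring k V l \<gamma>' B" and \<tau>: "\<tau> permutes {1..l}" for e \<gamma>' \<tau>
    unfolding compatible_instance_def Let_def sat_Alls
  proof (intro allI impI, elim conjE)
    fix e1 :: "var \<Rightarrow> nat"
    assume e1: "\<forall>v\<in>set (map VX [1..<card (universe U) + 1] @ map VY [1..<card (universe A) + 1]). e1 v \<in> universe M"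
    have e1X: "e1 (VX i) \<in> universe M" if "i \<in> {1..u}" for i
      using that u by (intro e1[rule_format]) (auto simp: image_iff)
    have e1Y: "e1 (VY j) \<in> universe M" if "j \<in> {1..\<alpha>}" for j
      using that \<alpha>\<beta>(1) by (intro e1[rule_format]) (auto simp: image_iff)
    let ?ant = "And (zeta V S U \<delta>) (And (chi V A VY) (theta V S (universe A) (restrict \<gamma>' (universe A)) \<tau>))"
    let ?con = "And (chi V B VY) (theta V S (universe B) \<gamma>' \<tau>)"
    have \<tau>\<gamma>: "\<tau> (\<gamma>' j) \<in> {1..l}" if "j \<in> {1..\<beta>}" for j
      using colouring_range[OF \<gamma>'] permutes_in_image[OF \<tau>] \<alpha>\<beta>(2) that by blast
    \<comment> \<open>The semantic consequences of the antecedent that the extension relies on, as a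
      predicate of the assignment so that two assignments can be compared.\<close>
    define F where "F e \<longleftrightarrow> (\<forall>i\<in>{1..l}. \<forall>j\<in>{1..l}. i \<noteq> j \<longrightarrow> \<gamma> (e (VX i)) \<noteq> \<gamma> (e (VX j))) \<and>
      embedding V (\<lambda>j. e (VY j)) A M \<and>
      (\<forall>j\<in>{1..\<alpha>}. \<gamma> (e (VX (\<tau> (\<gamma>' j)))) = \<gamma> (e (VY j)))" for e :: "var \<Rightarrow> nat"
    have xi: "sat M e (xi V S y z) \<longleftrightarrow> \<gamma> (e y) = \<gamma> (e z)"
      if "\<And>i. y \<noteq> VU i" "\<And>i. z \<noteq> VU i" "e y \<in> universe M" "e z \<in> universe M" for e y z
      by (rule sat_xi_generic[OF V S M that])
    have theta: "sat M e (theta V S D c \<tau>) \<longleftrightarrow> (\<forall>j\<in>D. \<gamma> (e (VX (\<tau> (c j)))) = \<gamma> (e (VY j)))"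
      if "finite D" "\<And>j. j \<in> D \<Longrightarrow> e (VX (\<tau> (c j))) \<in> universe M" "\<And>j. j \<in> D \<Longrightarrow> e (VY j) \<in> universe M"
      for e D c
    proof -
      have "finite {xi V S (VX (\<tau> (c j))) (VY j) | j. j \<in> D}"
        using that(1) by (simp add: setcompr_eq_image)
      then have "sat M e (theta V S D c \<tau>) \<longleftrightarrow> (\<forall>j\<in>D. sat M e (xi V S (VX (\<tau> (c j))) (VY j)))"
        unfolding theta_def by (subst sat_BigAnd) blast+
      then show ?thesis using xi that(2,3) by simp
    qed
    have F_if_ant: "F e"
      if sat: "sat M e ?ant" and eX: "\<And>i. i \<in> {1..u} \<Longrightarrow> e (VX i) \<in> universe M"
        and eY: "\<And>j. j \<in> {1..\<alpha>} \<Longrightarrow> e (VY j) \<in> universe M" for e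
    proof -
      have s: "sat M e (zeta V S U \<delta>)" "sat M e (chi V A VY)"
          "sat M e (theta V S (universe A) (restrict \<gamma>' (universe A)) \<tau>)"
        using sat by auto
      have emb: "embedding V (\<lambda>j. e (VY j)) A M"
        using sat_chi[OF V(1) A(1), of e VY M] s(2) eY \<alpha>\<beta>(1) by simp
      have "e (VX (\<tau> (\<gamma>' j))) \<in> universe M" if "j \<in> {1..\<alpha>}" for j
        using \<tau>\<gamma>[of j] eX lu that \<alpha>\<beta>(3) by auto
      then have th: "\<forall>j\<in>{1..\<alpha>}. \<gamma> (e (VX (\<tau> (\<gamma>' j)))) = \<gamma> (e (VY j))"
        using s(3) theta[of "{1..\<alpha>}" e "restrict \<gamma>' {1..\<alpha>}"] eY \<alpha>\<beta>(1) by simp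
      let ?N = "{Neg (xi V S (VX i) (VX j)) | i j. i \<in> universe U \<and> j \<in> universe U \<and> i < j \<and> \<delta> i \<noteq> \<delta> j}"
      have "finite ?N"
        by (rule finite_subset[of _ "(\<lambda>(i, j). Neg (xi V S (VX i) (VX j))) ` (universe U \<times> universe U)"])
          (auto simp: u)
      moreover have "sat M e (BigAnd ?N)"
        using s(1) by (simp add: zeta_def)
      ultimately have "\<forall>p\<in>?N. sat M e p"
        using sat_BigAnd by blast
      then have "\<not> sat M e (xi V S (VX i) (VX j))" if "i \<in> {1..u}" "j \<in> {1..u}" "i < j" "\<delta> i \<noteq> \<delta> j" for i j
        using that u by (metis (mono_tags, lifting) mem_Collect_eq sat.simps(1,4))
      \<comment> \<open>As \<delta> separates the indices up to l, the negated conjuncts of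
        \<open>zeta\<close> apply to these pairs. They are listed only for i < j; the next step
        symmetrises.\<close>
      then have less: "\<gamma> (e (VX i)) \<noteq> \<gamma> (e (VX j))" if "i \<in> {1..l}" "j \<in> {1..l}" "i < j" for i j
        using that xi[of "VX i" "VX j" e] eX lu inj_onD[OF inj, of i j] by blast
      have "\<gamma> (e (VX i)) \<noteq> \<gamma> (e (VX j))" if "i \<in> {1..l}" "j \<in> {1..l}" "i \<noteq> j" for i j
        using less[of i j] less[of j i] that by (metis linorder_neqE_nat)
      then show ?thesis using emb th unfolding F_def by blast
    qed
    \<comment> \<open>The colour in M named by the index i, after the permutation \<tau>.\<close>
    define \<psi> where "\<psi> = (\<lambda>i. \<gamma> (e1 (VX (\<tau> i))))"
    define c where "c = (\<lambda>j. \<psi> (\<gamma>' j))"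
    \<comment> \<open>The existential block stands in front of the implication, so the witnesses are
      chosen before the antecedent is evaluated, and some must exist even when it fails.\<close>
    have "\<exists>h. h ` {1..\<beta>} \<subseteq> universe M \<and> (\<forall>j\<in>{1..\<alpha>}. h j = e1 (VY j)) \<and>
        (F e1 \<longrightarrow> colour_embedding V c B \<gamma> M {1..\<beta>} h)"
    proof (cases "F e1")
      case True
      have "inj_on \<psi> {1..l}"
        using True permutes_in_image[OF \<tau>] permutes_inj[OF \<tau>]
        unfolding inj_on_def \<psi>_def F_def by (metis UNIV_I)
      then have "admissible k (map \<psi> (map \<gamma>' ts))" if "R \<in> syms V" "ts \<in> interp B R" for R ts
      proof (subst admissible_map_inj)
        show "inj_on \<psi> (set (map \<gamma>' ts))"
          using \<open>inj_on \<psi> {1..l}\<close> colouring_range[OF \<gamma>'] is_struct_set[OF A(2) that(2)]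
          by (elim inj_on_subset) auto
        show "admissible k (map \<gamma>' ts)" using \<gamma>' that by (simp add: colouring_def)
      qed
      then have adm: "admissible k (map c ts)" if "R \<in> syms V" "ts \<in> interp B R" for R ts
        using that by (simp add: c_def comp_def)
      have cr: "c j \<in> {1..l}" if "j \<in> {1..\<beta>}" for j
        unfolding c_def \<psi>_def using \<tau>\<gamma>[OF that] lu e1X colouring_range[OF colouredD(3)[OF M(2)]] by blast
      have "colour_embedding V c B \<gamma> M {1..\<alpha>} (\<lambda>j. e1 (VY j))"
        using True \<alpha>\<beta>(1) sub unfolding colour_embedding_def F_def embedding_def c_def \<psi>_def
        by (auto simp: tuples_def)
      then obtain h where h: "colour_embedding V c B \<gamma> M {1..\<beta>} h" "\<forall>j\<in>{1..\<alpha>}. h j = e1 (VY j)"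
        using extend_colour_embedding[OF M(1) M0, of "{1..\<beta>}" "{1..\<alpha>}" c B "\<lambda>j. e1 (VY j)"]
          AB(2) \<alpha>\<beta> cr adm by auto
      then show ?thesis by (intro exI[of _ h]) (auto simp: colour_embedding_def)
    next
      case False
      \<comment> \<open>A default witness for the case of a false antecedent; since l is at least 1,
        the variable \<open>VX 1\<close> is among the universally quantified ones.\<close>
      have "e1 (VX 1) \<in> universe M" using e1X lu l by auto
      then show ?thesis using False e1Y
        by (intro exI[of _ "\<lambda>j. if j \<in> {1..\<alpha>} then e1 (VY j) else e1 (VX 1)"]) auto
    qed
    then obtain h where h: "\<And>j. j \<in> {1..\<beta>} \<Longrightarrow> h j \<in> universe M" "\<And>j. j \<in> {1..\<alpha>} \<Longrightarrow> h j = e1 (VY j)"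
      "F e1 \<Longrightarrow> colour_embedding V c B \<gamma> M {1..\<beta>} h"
      by blast
    define e2 where "e2 w = (case w of VY j \<Rightarrow> if j \<in> {\<alpha> + 1..\<beta>} then h j else e1 w | _ \<Rightarrow> e1 w)" for w
    have e2X: "e2 (VX i) = e1 (VX i)" for i by (simp add: e2_def)
    have e2Y: "e2 (VY j) = h j" if "j \<in> {1..\<beta>}" for j
      using that h(2)[of j] by (auto simp: e2_def)
    have e2A: "e2 (VY j) = e1 (VY j)" if "j \<in> {1..\<alpha>}" for j
      using that by (simp add: e2_def)
    \<comment> \<open>The antecedent is evaluated at \<open>e2\<close>, while h was chosen from
      \<open>e1\<close>. They differ only at \<open>VY j\<close> with j > \<alpha>, on which
      \<open>F\<close> does not depend.\<close>
    have FF: "F e1" if "F e2"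
    proof -
      have F2: "\<forall>i\<in>{1..l}. \<forall>j\<in>{1..l}. i \<noteq> j \<longrightarrow> \<gamma> (e1 (VX i)) \<noteq> \<gamma> (e1 (VX j))"
        "embedding V (\<lambda>j. e2 (VY j)) A M"
        "\<forall>j\<in>{1..\<alpha>}. \<gamma> (e1 (VX (\<tau> (\<gamma>' j)))) = \<gamma> (e2 (VY j))"
        using that unfolding F_def e2X by blast+
      have "embedding V (\<lambda>j. e1 (VY j)) A M"
        using e2A \<alpha>\<beta>(1) by (intro embedding_cong[OF F2(2)]) simp
      moreover have "\<forall>j\<in>{1..\<alpha>}. \<gamma> (e1 (VX (\<tau> (\<gamma>' j)))) = \<gamma> (e1 (VY j))"
        using F2(3) e2A by simp
      ultimately show ?thesis using F2(1) unfolding F_def by blast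
    qed
    have "sat M e2 (Imp ?ant ?con)"
    proof (subst sat.simps, rule impI)
      assume "sat M e2 ?ant"
      then have "F e2" using e1X e1Y e2A e2X by (intro F_if_ant) auto
      then have "colour_embedding V c B \<gamma> M {1..\<beta>} h" using FF h(3) by blast
      then have emb: "embedding V h B M" and col: "\<And>j. j \<in> {1..\<beta>} \<Longrightarrow> \<gamma> (h j) = c j"
        using \<alpha>\<beta>(2) by (auto simp: colour_embedding_def embedding_def)
      have "embedding V (\<lambda>j. e2 (VY j)) B M"
        using e2Y \<alpha>\<beta>(2) by (intro embedding_cong[OF emb]) auto
      then have "sat M e2 (chi V B VY)"
        using sat_chi[OF V(1) A(2), of e2 VY M] \<alpha>\<beta>(2) e2Y h(1) by simp
      moreover have "sat M e2 (theta V S (universe B) \<gamma>' \<tau>)"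
        unfolding \<alpha>\<beta>(2)
      proof (subst theta)
        show "\<forall>j\<in>{1..\<beta>}. \<gamma> (e2 (VX (\<tau> (\<gamma>' j)))) = \<gamma> (e2 (VY j))"
          using e2X e2Y col by (simp add: c_def \<psi>_def)
        show "e2 (VX (\<tau> (\<gamma>' j))) \<in> universe M" if "j \<in> {1..\<beta>}" for j
          using \<tau>\<gamma>[OF that] e1X lu by (auto simp: e2X)
        show "e2 (VY j) \<in> universe M" if "j \<in> {1..\<beta>}" for j
          using e2Y h(1) that by simp
      qed simp
      ultimately show "sat M e2 ?con" by simp
    qed
    moreover have "e2 v \<in> universe M" if "v \<in> set (map VY [card (universe A) + 1..<card (universe B) + 1])" for v
      using that e2Y h(1) \<alpha>\<beta> by auto
    moreover have "e2 v = e1 v" if "v \<notin> set (map VY [card (universe A) + 1..<card (universe B) + 1])" for v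
      using that \<alpha>\<beta> by (auto simp: e2_def split: var.splits)
    ultimately show "sat M e1 (Exs (map VY [card (universe A) + 1..<card (universe B) + 1]) (Imp ?ant ?con))"
      unfolding sat_Exs by blast
  qed
  moreover have "finite {compatible_instance V S U \<delta> A B \<gamma>' \<tau> | \<gamma>' \<tau>. colouring k V l \<gamma>' B \<and> \<tau> permutes {1..l}}"
  proof (rule finite_subset)
    show "{compatible_instance V S U \<delta> A B \<gamma>' \<tau> | \<gamma>' \<tau>. colouring k V l \<gamma>' B \<and> \<tau> permutes {1..l}} \<subseteq>
      (\<lambda>(\<gamma>', \<tau>). compatible_instance V S U \<delta> A B \<gamma>' \<tau>) `
        ((universe B \<rightarrow>\<^sub>E {1..l}) \<times> {\<tau>. \<tau> permutes {1..l}})"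
      unfolding colouring_def by fast
    show "finite ((\<lambda>(\<gamma>', \<tau>). compatible_instance V S U \<delta> A B \<gamma>' \<tau>) `
        ((universe B \<rightarrow>\<^sub>E {1..l}) \<times> {\<tau>. \<tau> permutes {1..l}}))"
      using \<alpha>\<beta>(2) by (intro finite_imageI finite_cartesian_product finite_permutations) (simp_all add: finite_PiE)
  qed
  ultimately show ?thesis
    unfolding models_def compatible_axiom_def by (subst sat_BigAnd) auto
qed

section \<open>Zero-one laws\<close>

text \<open>Truth of a relational sentence can be tested in an expansion by any colouring, which
  brings the back-and-forth theorem for coloured structures to bear on reducts.\<close>

lemma sat_expand_map_form: "sat (expand \<gamma> M) e (map_form Inl p) \<longleftrightarrow> sat M e p"
  by (induction p arbitrary: e) simp_all

lemma sentence_map_form: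
  fixes p :: "'a form"
  assumes "sentence V p"
  shows "sentence (colour_vocab V l) (map_form Inl p)"
proof -
  have "fv (map_form Inl p :: ('a + nat) form) = fv p" for p :: "'a form" by (induction p) simp_all
  moreover have "form_of (colour_vocab V l) (map_form Inl p) \<longleftrightarrow> form_of V p" for p
    by (induction p) auto
  ultimately show ?thesis using assms by (simp add: sentence_def)
qed

lemma proportion_KK:
  "proportion (KK k V l n) P = proportion (coloured k V l n) (\<lambda>(\<gamma>, M). P (expand \<gamma> M))"
proof -
  let ?X = "coloured k V l n" and ?h = "\<lambda>(\<gamma>, M). expand \<gamma> M"
  have "{N \<in> KK k V l n. P N} = ?h ` {(\<gamma>, M) \<in> ?X. P (expand \<gamma> M)}"
    unfolding KK_eq by auto
  moreover have "card (?h ` {(\<gamma>, M) \<in> ?X. P (expand \<gamma> M)}) = card {(\<gamma>, M) \<in> ?X. P (expand \<gamma> M)}"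
    by (rule card_image) (rule inj_on_subset[OF inj_on_expand], auto)
  moreover have "card (KK k V l n) = card ?X"
    unfolding KK_eq by (rule card_image[OF inj_on_expand])
  ultimately show ?thesis by (simp add: proportion_def case_prod_unfold)
qed

lemma richly_coloured_expand: "richly_coloured l r (expand \<gamma> M) \<longleftrightarrow> rich l r \<gamma> M"
  by (simp add: richly_coloured_def rich_def)

lemma coloured_zero_one_law:
  assumes V: "finite (syms V)" "syms V \<noteq> {}" and ar: "\<forall>R\<in>syms V. 2 \<le> arity V R"
    and f: "filterlim (\<lambda>n. f n / ln (real n)) at_top sequentially"
    and rich: "(\<lambda>n. proportion (KK k V l n) (richly_coloured l (f n))) \<longlonglongrightarrow> 1"
  shows "(\<forall>A B. extension_pair k V l A B \<longrightarrow>
           (\<lambda>n. proportion (KK k V l n) (satisfies_extension_axiom (colour_vocab V l) A B)) \<longlonglongrightarrow> 1) \<and>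
         zero_one_law (colour_vocab V l) (KK k V l)"
proof (intro conjI allI impI)
  have gen: "(\<lambda>n. proportion (coloured k V l n) (\<lambda>(\<gamma>, M). generic k V l m \<gamma> M)) \<longlonglongrightarrow> 1" for m
    using rich unfolding proportion_KK richly_coloured_expand
    by (rule almost_all_coloured_generic[OF V f])
  show "(\<lambda>n. proportion (KK k V l n) (satisfies_extension_axiom (colour_vocab V l) A B)) \<longlonglongrightarrow> 1"
    if "extension_pair k V l A B" for A B
    unfolding proportion_KK
    by (rule proportion_tendsto_1_mono[OF finite_coloured[OF V(1)] gen])
      (auto intro: generic_satisfies_extension_axiom[OF that])
  show "zero_one_law (colour_vocab V l) (KK k V l)"
    unfolding zero_one_law_def proportion_KK
  proof (intro allI impI)
    fix p assume p: "sentence (colour_vocab V l) p"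
    show "(\<lambda>n. proportion (coloured k V l n) (\<lambda>(\<gamma>, M). models (expand \<gamma> M) p)) \<longlonglongrightarrow> 0 \<or>
        (\<lambda>n. proportion (coloured k V l n) (\<lambda>(\<gamma>, M). models (expand \<gamma> M) p)) \<longlonglongrightarrow> 1"
    proof (rule proportion_dichotomy[OF finite_coloured[OF V(1)] gen[of "quantifiers p"]])
      fix n n' x x'
      assume "x \<in> coloured k V l n" "case x of (\<gamma>, M) \<Rightarrow> generic k V l (quantifiers p) \<gamma> M"
        "x' \<in> coloured k V l n'" "case x' of (\<gamma>, M) \<Rightarrow> generic k V l (quantifiers p) \<gamma> M"
      then show "(case x of (\<gamma>, M) \<Rightarrow> models (expand \<gamma> M) p) \<longleftrightarrow>
          (case x' of (\<gamma>, M) \<Rightarrow> models (expand \<gamma> M) p)"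
        using generic_models_iff[OF _ _ _ _ p ar, of k "fst x" "snd x" n "fst x'" "snd x'" n']
        by (simp add: case_prod_unfold)
    qed
  qed
qed

lemma colourable_zero_one_law:
  assumes V: "finite (syms V)" "syms V \<noteq> {}" and ar: "\<forall>R\<in>syms V. 2 \<le> arity V R"
    and l: "2 \<le> l" and k: "k = Strong \<Longrightarrow> \<forall>R\<in>syms V. arity V R \<le> l"
    and f: "filterlim (\<lambda>n. f n / ln (real n)) at_top sequentially"
    and rich: "(\<lambda>n. proportion (CC k V l n) (has_rich_colouring k V l (f n))) \<longlonglongrightarrow> 1"
  shows "(\<forall>S U \<delta> A B. xi_structure k V l S \<and> zeta_structure k V l U \<delta> \<and> compatible_pair k V l A B \<longrightarrow>
           (\<lambda>n. proportion (CC k V l n) (\<lambda>M. models M (compatible_axiom k V l S U \<delta> A B))) \<longlonglongrightarrow> 1) \<and>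
         zero_one_law V (CC k V l)"
proof (intro conjI allI impI)
  obtain R where "R \<in> syms V" using V(2) by blast
  \<comment> \<open>Genericity of almost all reducts needs some such structure, even for the
    zero-one law alone. In the strong case, this is where the bound on the arities enters.\<close>
  then obtain S0 where S0: "xi_structure k V l S0"
    using ex_xi_structure[of R V l k] ar l k by blast
  have finCC: "finite (CC k V l n)" for n
    unfolding CC_eq using finite_coloured[OF V(1)] by simp
  have gen: "(\<lambda>n. proportion (CC k V l n) (has_generic_colouring k V l m n)) \<longlonglongrightarrow> 1" for m
    by (rule almost_all_colourable_generic[OF V ar S0 f rich])
  show "(\<lambda>n. proportion (CC k V l n) (\<lambda>M. models M (compatible_axiom k V l S U \<delta> A B))) \<longlonglongrightarrow> 1"
    if *: "xi_structure k V l S \<and> zeta_structure k V l U \<delta> \<and> compatible_pair k V l A B" for S U \<delta> A B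
  proof -
    obtain s where s: "universe S = {1..s}" using * unfolding xi_structure_def by blast
    show ?thesis
    \<comment> \<open>The S of the axiom may differ from \<open>S0\<close>; the threshold leaves
      room for a copy of S as well as for B.\<close>
    proof (rule proportion_tendsto_1_mono[OF finCC gen[of "max s (card (universe B))"]])
      fix n M assume "has_generic_colouring k V l (max s (card (universe B))) n M"
      then obtain \<gamma> where "(\<gamma>, M) \<in> coloured k V l n" "generic k V l (max s (card (universe B))) \<gamma> M"
        unfolding has_generic_colouring_def by blast
      then show "models M (compatible_axiom k V l S U \<delta> A B)"
        using * l by (intro generic_models_compatible_axiom[OF V(1) ar _ s]) auto
    qed
  qed
  show "zero_one_law V (CC k V l)"
    unfolding zero_one_law_def
  proof (intro allI impI)
    fix p assume "sentence V p"
    then have p: "sentence (colour_vocab V l) (map_form Inl p)" by (rule sentence_map_form)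
    let ?q = "quantifiers (map_form Inl p :: ('a + nat) form)"
    have models: "models M p \<longleftrightarrow> models (expand \<gamma> M) (map_form Inl p)" for \<gamma> M
      by (simp add: models_def sat_expand_map_form)
    show "(\<lambda>n. proportion (CC k V l n) (\<lambda>M. models M p)) \<longlonglongrightarrow> 0 \<or>
        (\<lambda>n. proportion (CC k V l n) (\<lambda>M. models M p)) \<longlonglongrightarrow> 1"
    proof (rule proportion_dichotomy[OF finCC gen[of ?q]])
      fix n n' M M'
      assume "has_generic_colouring k V l ?q n M" "has_generic_colouring k V l ?q n' M'"
      then obtain \<gamma> \<gamma>' where "(\<gamma>, M) \<in> coloured k V l n" "generic k V l ?q \<gamma> M"
        "(\<gamma>', M') \<in> coloured k V l n'" "generic k V l ?q \<gamma>' M'"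
        unfolding has_generic_colouring_def by blast
      then show "models M p \<longleftrightarrow> models M' p"
        unfolding models[of M \<gamma>] models[of M' \<gamma>'] by (intro generic_models_iff[OF _ _ _ _ p ar])
    qed
  qed
qed

theorem theorem9p16:
  fixes V :: "'r vocab" and l :: nat and f :: "nat \<Rightarrow> real"
  assumes "finite (syms V)" and "syms V \<noteq> {}"
    and "\<forall>R\<in>syms V. 2 \<le> arity V R"
    and "2 \<le> l"
    and "filterlim (\<lambda>n. f n / ln (real n)) at_top sequentially"
  shows
    "((\<lambda>n. proportion (KK Plain V l n) (richly_coloured l (f n))) \<longlonglongrightarrow> 1 \<longrightarrow>
        (\<forall>A B. extension_pair Plain V l A B \<longrightarrow>
           (\<lambda>n. proportion (KK Plain V l n)
                  (satisfies_extension_axiom (colour_vocab V l) A B)) \<longlonglongrightarrow> 1) \<and>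
        zero_one_law (colour_vocab V l) (KK Plain V l))
     \<and>
     ((\<lambda>n. proportion (CC Plain V l n) (has_rich_colouring Plain V l (f n))) \<longlonglongrightarrow> 1 \<longrightarrow>
        (\<forall>S U \<delta> A B. xi_structure Plain V l S \<and> zeta_structure Plain V l U \<delta> \<and>
             compatible_pair Plain V l A B \<longrightarrow>
           (\<lambda>n. proportion (CC Plain V l n)
                  (\<lambda>M. models M (compatible_axiom Plain V l S U \<delta> A B))) \<longlonglongrightarrow> 1) \<and>
        zero_one_law V (CC Plain V l))
     \<and>
     ((\<forall>R\<in>syms V. arity V R \<le> l) \<longrightarrow>
       ((\<lambda>n. proportion (KK Strong V l n) (richly_coloured l (f n))) \<longlonglongrightarrow> 1 \<longrightarrow>
          (\<forall>A B. extension_pair Strong V l A B \<longrightarrow>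
             (\<lambda>n. proportion (KK Strong V l n)
                    (satisfies_extension_axiom (colour_vocab V l) A B)) \<longlonglongrightarrow> 1) \<and>
          zero_one_law (colour_vocab V l) (KK Strong V l))
       \<and>
       ((\<lambda>n. proportion (CC Strong V l n) (has_rich_colouring Strong V l (f n))) \<longlonglongrightarrow> 1 \<longrightarrow>
          (\<forall>S U \<delta> A B. xi_structure Strong V l S \<and> zeta_structure Strong V l U \<delta> \<and>
               compatible_pair Strong V l A B \<longrightarrow>
             (\<lambda>n. proportion (CC Strong V l n)
                    (\<lambda>M. models M (compatible_axiom Strong V l S U \<delta> A B))) \<longlonglongrightarrow> 1) \<and>
          zero_one_law V (CC Strong V l)))"
  using coloured_zero_one_law[OF assms(1-3,5), where l = l and k = Plain]
    colourable_zero_one_law[OF assms(1-4) _ assms(5), where k = Plain]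
    coloured_zero_one_law[OF assms(1-3,5), where l = l and k = Strong]
    colourable_zero_one_law[OF assms(1-4) _ assms(5), where k = Strong]
  by (simp only: kind.distinct simp_thms) blast

end
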